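(* Let $p$ be a prime, let $(S,w)$ be a complete filtered $\mathbb Z_p$-algebra and let $(\sigma,\delta)$ be a commuting skew derivation on $S$ such that $\sigma^{p^r}$ is strictly filtered for some $r$. Suppose there exists $t\in S$ such that $\delta(s)=ts-\sigma(s)t$ for all $s\in S$, satisfying $\sigma(t)=t$, and assume that $w(t)\ge0$ when $p\ne0$ in $S$. For $n\in\mathbb N$ set $T_n=(-1)^{p+1}t^{p^n}$, $X_n=(x-t)^{p^n}+T_n\in S[x;\sigma,\delta]$, $\Sigma_n=\sigma^{p^n}$ and $\Delta_n(s)=T_ns-\Sigma_n(s)T_n$. Then the following are equivalent: (a) $(\sigma,\delta)$ is quasi-compatible with $w$. (b) $(\Sigma_n,\Delta_n)$ is quasi-compatible with $w$ for all $n\in\mathbb N$. (c) $(\Sigma_n,\Delta_n)$ is quasi-compatible with $w$ for some $n\in\mathbb N$. In particular, the bounded skew power series ring $S^+[[x;\sigma,\delta]]$ exists if and only if any $S^+[[Y;\Sigma_n,\Delta_n]]$ exists. Moreover, when these conditions hold, for any $n \in \mathbb{N}$ and any sufficiently small rational $\varepsilon>0$, the natural map $\theta:(S[Y;\Sigma_n,\Delta_n],v_{Y,\varepsilon})\to(S^+[[x;\sigma,\delta]],v_{x,\varepsilon})$ extending the identity map on $S$ and sending $Y$ to $X_n$ is a filtered ring homomorphism of non-negative degree.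
   Context: A filtration on a ring $R$ is a function $u:R\to\mathbb Z\cup\{\infty\}$ with $u(a+b)\ge\min\{u(a),u(b)\}$, $u(a)=\infty$ iff $a=0$, $u(1)=0$, $u(ab)\ge u(a)+u(b)$; $F_nR=u^{-1}([n,\infty])$. Complete means every Cauchy sequence converges. $(R,u)$ is a filtered $\mathbb Z_p$-algebra if $R$ is a $\mathbb Z_p$-algebra and $u(n\cdot1)\ge v_p(n)$ for all $n\in\mathbb Z_p$. A homomorphism $f$ of filtered abelian groups $A\to B$ is filtered if $f(F_nA)\subseteq F_{n+d}B$ for all $n$, for some $d$; its degree $\deg(f)$ is the largest such $d$; it is strictly filtered if $f(F_nA)=f(A)\cap F_nB$ for all $n$. A skew derivation $(\sigma,\delta)$ is $\sigma\in\mathrm{Aut}(R)$ with an additive $\delta$ satisfying $\delta(rs)=\delta(r)s+\sigma(r)\delta(s)$; commuting means $\sigma\delta=\delta\sigma$. A commuting skew derivation is quasi-compatible with $u$ if $\sigma,\sigma^{-1},\delta$ are filtered, the degrees $\deg_u(\sigma^i\delta^j)$ ($i\in\mathbb Z,j\in\mathbb N$) have a common lower bound, and $\deg_u(\delta^N)>0$ for some $N\in\mathbb N$. The skew polynomial ring $R[x;\sigma,\delta]$ has $xr=\sigma(r)x+\delta(r)$. In the quasi-compatible case with $(S,w)$ complete, $S^+[[x;\sigma,\delta]]$ is the ring of power series $\sum_ns_nx^n$ with $w(s_n)$ bounded below, with multiplication $(\sum a_ix^i)(\sum b_jx^j)=\sum_k\big(\sum_{0\le e\le k}\sum_{i\ge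 e}\binom ie a_i\sigma^e\delta^{i-e}(b_{k-e})\big)x^k$, and $v_{x,\varepsilon}(\sum s_nx^n)=\min_n\{w(s_n)+\varepsilon n\}$ (similarly $v_{Y,\varepsilon}$ with $Y$ in place of $x$); these take values in $(\mathbb Z+\varepsilon\mathbb Z)\cup\{\infty\}$.
   Formalization: It is additionally assumed that σ is a filtered map; for an arbitrary ring automorphism σ, (c) does not imply (a): there is a non-filtered σ with σ² = id, p = 2 and t = 0 for which (c) holds with n = 1. *)

theory Defs
  imports
    "HOL-Library.Extended_Real"
    "HOL-Computational_Algebra.Polynomial"
    "HOL-Computational_Algebra.Primes"
    "HOL-Algebra.RingHom"
    "HOL-Algebra.Algebraic_Closure_Type"
begin

text \<open>
  \<open>\<int>\<^sub>p\<close> is realised as the inverse limit of the rings \<open>\<int>/p\<^sup>n\<close>: an element is a coherent sequence of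
  least non-negative residues, its \<open>n\<close>-th entry being its residue modulo \<open>p ^ n\<close>.
\<close>

definition padic_int :: "nat \<Rightarrow> (nat \<Rightarrow> int) ring" where
  "padic_int p = \<lparr>
     carrier = {a. \<forall>n. a n \<in> {0..<int p ^ n} \<and> a (Suc n) mod int p ^ n = a n},
     monoid.mult = (\<lambda>a b n. (a n * b n) mod int p ^ n),
     one = (\<lambda>n. 1 mod int p ^ n),
     ring.zero = (\<lambda>n. 0),
     add = (\<lambda>a b n. (a n + b n) mod int p ^ n)\<rparr>"

text \<open>
  For \<open>a\<close> in \<open>\<int>\<^sub>p\<close> one has \<open>a n = 0\<close> iff \<open>p ^ n\<close> divides \<open>a\<close>; so this is the \<open>p\<close>-adic valuation,
  with value \<open>\<infinity>\<close> at \<open>0\<close>.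
\<close>

definition padic_val :: "(nat \<Rightarrow> int) \<Rightarrow> ereal" where
  "padic_val a = Sup {ereal (real n) | n. a n = 0}"

definition ring_filtration :: "('a::ring_1 \<Rightarrow> ereal) \<Rightarrow> bool" where
  "ring_filtration u \<longleftrightarrow>
     (\<forall>a. u a = \<infinity> \<or> (\<exists>k::int. u a = ereal (of_int k))) \<and>
     (\<forall>a b. min (u a) (u b) \<le> u (a + b)) \<and>
     (\<forall>a. u a = \<infinity> \<longleftrightarrow> a = 0) \<and>
     u 1 = 0 \<and>
     (\<forall>a b. u a + u b \<le> u (a * b))"

text \<open>\<open>\<iota>\<close> is the structure map of the \<open>\<int>\<^sub>p\<close>-algebra, that is, \<open>\<iota> n\<close> is \<open>n \<cdot> 1\<close>.\<close>

definition filtered_padic_algebra ::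
    "nat \<Rightarrow> ((nat \<Rightarrow> int) \<Rightarrow> 'a::ring_1) \<Rightarrow> ('a \<Rightarrow> ereal) \<Rightarrow> bool" where
  "filtered_padic_algebra p \<iota> u \<longleftrightarrow>
     ring_filtration u \<and>
     \<iota> \<in> ring_hom (padic_int p) ring_of_type_algebra \<and>
     (\<forall>n\<in>carrier (padic_int p). \<forall>s. \<iota> n * s = s * \<iota> n) \<and>
     (\<forall>n\<in>carrier (padic_int p). padic_val n \<le> u (\<iota> n))"

definition filt_tendsto :: "('a::ring_1 \<Rightarrow> ereal) \<Rightarrow> (nat \<Rightarrow> 'a) \<Rightarrow> 'a \<Rightarrow> bool" where
  "filt_tendsto u a l \<longleftrightarrow> (\<forall>k::int. \<exists>M. \<forall>n\<ge>M. ereal (of_int k) \<le> u (a n - l))"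

definition filt_Cauchy :: "('a::ring_1 \<Rightarrow> ereal) \<Rightarrow> (nat \<Rightarrow> 'a) \<Rightarrow> bool" where
  "filt_Cauchy u a \<longleftrightarrow> (\<forall>k::int. \<exists>M. \<forall>m\<ge>M. \<forall>n\<ge>M. ereal (of_int k) \<le> u (a m - a n))"

definition filt_complete :: "('a::ring_1 \<Rightarrow> ereal) \<Rightarrow> bool" where
  "filt_complete u \<longleftrightarrow> (\<forall>a. filt_Cauchy u a \<longrightarrow> (\<exists>l. filt_tendsto u a l))"

definition filt_sums :: "('a::ring_1 \<Rightarrow> ereal) \<Rightarrow> (nat \<Rightarrow> 'a) \<Rightarrow> 'a \<Rightarrow> bool" where
  "filt_sums u f l \<longleftrightarrow> filt_tendsto u (\<lambda>n. \<Sum>i<n. f i) l"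

definition filt_suminf :: "('a::ring_1 \<Rightarrow> ereal) \<Rightarrow> (nat \<Rightarrow> 'a) \<Rightarrow> 'a" where
  "filt_suminf u f = (THE l. filt_sums u f l)"

text \<open>
  A filtered abelian group is given by its carrier \<open>A\<close> and its filtration \<open>u\<close>. The filtrations on \<open>S\<close>
  have value group \<open>\<int>\<close>, those on polynomials and power series have value group \<open>\<int> + \<epsilon>\<int>\<close>; therefore the
  value group \<open>\<Gamma>\<close> is a parameter.
\<close>

definition filt_level :: "'a set \<Rightarrow> ('a \<Rightarrow> ereal) \<Rightarrow> real \<Rightarrow> 'a set" where
  "filt_level A u n = {a \<in> A. ereal n \<le> u a}"

definition shifts_by ::
    "real set \<Rightarrow> 'a set \<Rightarrow> ('a \<Rightarrow> ereal) \<Rightarrow> 'b set \<Rightarrow> ('b \<Rightarrow> ereal) \<Rightarrow> ('a \<Rightarrow> 'b) \<Rightarrow> real \<Rightarrow> bool" where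
  "shifts_by \<Gamma> A u B v f d \<longleftrightarrow> (\<forall>n\<in>\<Gamma>. f ` filt_level A u n \<subseteq> filt_level B v (n + d))"

definition filtered_map ::
    "real set \<Rightarrow> 'a set \<Rightarrow> ('a \<Rightarrow> ereal) \<Rightarrow> 'b set \<Rightarrow> ('b \<Rightarrow> ereal) \<Rightarrow> ('a \<Rightarrow> 'b) \<Rightarrow> bool" where
  "filtered_map \<Gamma> A u B v f \<longleftrightarrow> (\<exists>d\<in>\<Gamma>. shifts_by \<Gamma> A u B v f d)"

text \<open>
  For a discrete \<open>\<Gamma>\<close> the supremum is attained whenever \<open>f\<close> is filtered and non-zero. By this convention
  the zero map has degree \<open>\<infinity>\<close>, and a map that is not filtered has degree \<open>-\<infinity>\<close>.
\<close>

definition filt_degree ::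
    "real set \<Rightarrow> 'a set \<Rightarrow> ('a \<Rightarrow> ereal) \<Rightarrow> 'b set \<Rightarrow> ('b \<Rightarrow> ereal) \<Rightarrow> ('a \<Rightarrow> 'b) \<Rightarrow> ereal" where
  "filt_degree \<Gamma> A u B v f = Sup {ereal d | d. d \<in> \<Gamma> \<and> shifts_by \<Gamma> A u B v f d}"

definition strictly_filtered_map ::
    "real set \<Rightarrow> 'a set \<Rightarrow> ('a \<Rightarrow> ereal) \<Rightarrow> 'b set \<Rightarrow> ('b \<Rightarrow> ereal) \<Rightarrow> ('a \<Rightarrow> 'b) \<Rightarrow> bool" where
  "strictly_filtered_map \<Gamma> A u B v f \<longleftrightarrow>
     (\<forall>n\<in>\<Gamma>. f ` filt_level A u n = f ` A \<inter> filt_level B v n)"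

abbreviation filtered_endo :: "('a \<Rightarrow> ereal) \<Rightarrow> ('a \<Rightarrow> 'a) \<Rightarrow> bool" where
  "filtered_endo u \<equiv> filtered_map \<int> UNIV u UNIV u"

abbreviation degree_endo :: "('a \<Rightarrow> ereal) \<Rightarrow> ('a \<Rightarrow> 'a) \<Rightarrow> ereal" where
  "degree_endo u \<equiv> filt_degree \<int> UNIV u UNIV u"

abbreviation strictly_filtered_endo :: "('a \<Rightarrow> ereal) \<Rightarrow> ('a \<Rightarrow> 'a) \<Rightarrow> bool" where
  "strictly_filtered_endo u \<equiv> strictly_filtered_map \<int> UNIV u UNIV u"

definition skew_derivation :: "('a::ring_1 \<Rightarrow> 'a) \<Rightarrow> ('a \<Rightarrow> 'a) \<Rightarrow> bool" where
  "skew_derivation \<sigma> \<delta> \<longleftrightarrow>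
     \<sigma> \<in> ring_iso ring_of_type_algebra ring_of_type_algebra \<and>
     (\<forall>r s. \<delta> (r + s) = \<delta> r + \<delta> s) \<and>
     (\<forall>r s. \<delta> (r * s) = \<delta> r * s + \<sigma> r * \<delta> s)"

definition commuting_skew_derivation :: "('a::ring_1 \<Rightarrow> 'a) \<Rightarrow> ('a \<Rightarrow> 'a) \<Rightarrow> bool" where
  "commuting_skew_derivation \<sigma> \<delta> \<longleftrightarrow> skew_derivation \<sigma> \<delta> \<and> \<sigma> \<circ> \<delta> = \<delta> \<circ> \<sigma>"

definition int_funpow :: "('a \<Rightarrow> 'a) \<Rightarrow> int \<Rightarrow> 'a \<Rightarrow> 'a" where
  "int_funpow \<sigma> i = (if 0 \<le> i then \<sigma> ^^ nat i else inv_into UNIV \<sigma> ^^ nat (- i))"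

definition quasi_compatible ::
    "('a::ring_1 \<Rightarrow> ereal) \<Rightarrow> ('a \<Rightarrow> 'a) \<Rightarrow> ('a \<Rightarrow> 'a) \<Rightarrow> bool" where
  "quasi_compatible u \<sigma> \<delta> \<longleftrightarrow>
     commuting_skew_derivation \<sigma> \<delta> \<and>
     filtered_endo u \<sigma> \<and> filtered_endo u (inv_into UNIV \<sigma>) \<and> filtered_endo u \<delta> \<and>
     (\<exists>B::int. \<forall>(i::int) (j::nat).
        ereal (of_int B) \<le> degree_endo u (int_funpow \<sigma> i \<circ> \<delta> ^^ j)) \<and>
     (\<exists>N::nat. 0 < degree_endo u (\<delta> ^^ N))"

text \<open>
  Elements are polynomials with coefficients written on the left of the powers of the variable.
  Only the additive structure of the type \<open>poly\<close> is used. Left multiplication by the variable is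
  dictated by \<open>x r = \<sigma>(r) x + \<delta>(r)\<close>.
\<close>

definition skew_var_mult :: "('a::ring_1 \<Rightarrow> 'a) \<Rightarrow> ('a \<Rightarrow> 'a) \<Rightarrow> 'a poly \<Rightarrow> 'a poly" where
  "skew_var_mult \<sigma> \<delta> g = pCons 0 (map_poly \<sigma> g) + map_poly \<delta> g"

definition skew_poly_mult ::
    "('a::ring_1 \<Rightarrow> 'a) \<Rightarrow> ('a \<Rightarrow> 'a) \<Rightarrow> 'a poly \<Rightarrow> 'a poly \<Rightarrow> 'a poly" where
  "skew_poly_mult \<sigma> \<delta> f g =
     (\<Sum>i\<le>Polynomial.degree f. map_poly ((*) (poly.coeff f i)) ((skew_var_mult \<sigma> \<delta> ^^ i) g))"

definition skew_poly_ring :: "('a::ring_1 \<Rightarrow> 'a) \<Rightarrow> ('a \<Rightarrow> 'a) \<Rightarrow> 'a poly ring" where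
  "skew_poly_ring \<sigma> \<delta> = \<lparr>
     carrier = UNIV,
     monoid.mult = skew_poly_mult \<sigma> \<delta>,
     one = [:1:],
     ring.zero = 0,
     add = (+)\<rparr>"

text \<open>
  The power series \<open>\<Sum>n. s\<^sub>n x\<^sup>n\<close> is the function \<open>s\<close>; accordingly \<open>poly.coeff\<close> is the
  inclusion of polynomials into power series.
\<close>

definition bounded_series :: "('a::ring_1 \<Rightarrow> ereal) \<Rightarrow> (nat \<Rightarrow> 'a) set" where
  "bounded_series u = {s. \<exists>B::int. \<forall>n. ereal (of_int B) \<le> u (s n)}"

text \<open>
  The summand of the product formula for the coefficient of \<open>x ^ k\<close>, with the inner index \<open>i \<ge> e\<close> replaced
  by \<open>i + e\<close> where \<open>i \<ge> 0\<close>.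
\<close>

definition skew_series_term ::
    "('a::ring_1 \<Rightarrow> 'a) \<Rightarrow> ('a \<Rightarrow> 'a) \<Rightarrow> (nat \<Rightarrow> 'a) \<Rightarrow> (nat \<Rightarrow> 'a) \<Rightarrow> nat \<Rightarrow> nat \<Rightarrow> nat \<Rightarrow> 'a" where
  "skew_series_term \<sigma> \<delta> a b k e i =
     of_nat ((i + e) choose e) * a (i + e) * (\<sigma> ^^ e) ((\<delta> ^^ i) (b (k - e)))"

definition skew_series_mult ::
    "('a::ring_1 \<Rightarrow> ereal) \<Rightarrow> ('a \<Rightarrow> 'a) \<Rightarrow> ('a \<Rightarrow> 'a) \<Rightarrow> (nat \<Rightarrow> 'a) \<Rightarrow> (nat \<Rightarrow> 'a) \<Rightarrow> nat \<Rightarrow> 'a" where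
  "skew_series_mult u \<sigma> \<delta> a b =
     (\<lambda>k. \<Sum>e\<le>k. filt_suminf u (skew_series_term \<sigma> \<delta> a b k e))"

definition skew_series_ring ::
    "('a::ring_1 \<Rightarrow> ereal) \<Rightarrow> ('a \<Rightarrow> 'a) \<Rightarrow> ('a \<Rightarrow> 'a) \<Rightarrow> (nat \<Rightarrow> 'a) ring" where
  "skew_series_ring u \<sigma> \<delta> = \<lparr>
     carrier = bounded_series u,
     monoid.mult = skew_series_mult u \<sigma> \<delta>,
     one = (\<lambda>n. if n = 0 then 1 else 0),
     ring.zero = (\<lambda>n. 0),
     add = (\<lambda>a b n. a n + b n)\<rparr>"

text \<open>
  The ring is only formed for complete \<open>u\<close> and quasi-compatible \<open>(\<sigma>, \<delta>)\<close>. It exists if moreover all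
  infinite sums in the product formula converge and the operations make the bounded series a ring.
\<close>

definition skew_series_ring_exists ::
    "('a::ring_1 \<Rightarrow> ereal) \<Rightarrow> ('a \<Rightarrow> 'a) \<Rightarrow> ('a \<Rightarrow> 'a) \<Rightarrow> bool" where
  "skew_series_ring_exists u \<sigma> \<delta> \<longleftrightarrow>
     ring_filtration u \<and> filt_complete u \<and> quasi_compatible u \<sigma> \<delta> \<and>
     (\<forall>a\<in>bounded_series u. \<forall>b\<in>bounded_series u. \<forall>k. \<forall>e\<le>k.
        \<exists>l. filt_sums u (skew_series_term \<sigma> \<delta> a b k e) l) \<and>
     ring (skew_series_ring u \<sigma> \<delta>)"

definition series_filtration :: "('a \<Rightarrow> ereal) \<Rightarrow> real \<Rightarrow> (nat \<Rightarrow> 'a) \<Rightarrow> ereal" where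
  "series_filtration u \<epsilon> s = (INF n. u (s n) + ereal (\<epsilon> * real n))"

definition poly_filtration :: "('a::zero \<Rightarrow> ereal) \<Rightarrow> real \<Rightarrow> 'a poly \<Rightarrow> ereal" where
  "poly_filtration u \<epsilon> f = series_filtration u \<epsilon> (poly.coeff f)"

definition value_group :: "real \<Rightarrow> real set" where
  "value_group \<epsilon> = {of_int a + \<epsilon> * of_int b | a b. True}"

text \<open>
  The natural map \<open>\<Sum>i. s\<^sub>i Y\<^sup>i \<mapsto> \<Sum>i. s\<^sub>i g\<^sup>i\<close> into the power series ring in the variable \<open>x\<close>.
\<close>

definition skew_subst ::
    "('a::ring_1 \<Rightarrow> ereal) \<Rightarrow> ('a \<Rightarrow> 'a) \<Rightarrow> ('a \<Rightarrow> 'a) \<Rightarrow> 'a poly \<Rightarrow> 'a poly \<Rightarrow> nat \<Rightarrow> 'a" where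
  "skew_subst u \<sigma> \<delta> g f =
     (let R = skew_series_ring u \<sigma> \<delta>
      in finsum R (\<lambda>i. poly.coeff [:poly.coeff f i:] \<otimes>\<^bsub>R\<^esub> (poly.coeff g [^]\<^bsub>R\<^esub> i))
           {..Polynomial.degree f})"

end

theory Submission
  imports Defs
begin

text \<open>
  All the \<open>\<sigma>\<close>-powers are uniformly filtered because a power of \<open>\<sigma>\<close> is an isometry, and \<open>\<delta>\<close>, \<open>\<Delta>\<^sub>n\<close> are
  filtered because they are inner. So quasi-compatibility of \<open>(\<sigma>, \<delta>)\<close> only says that some power of \<open>\<delta>\<close>
  has positive degree, and similarly for \<open>\<Delta>\<^sub>n\<close>. Since \<open>\<delta>\<close> is the difference of the commuting operators
  \<open>s \<mapsto> t s\<close> and \<open>s \<mapsto> \<sigma>(s) t\<close>, the binomial theorem gives \<open>\<Delta>\<^sub>n = \<delta> ^ (p ^ n) + p h\<close> with \<open>h\<close> commuting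
  with \<open>\<delta>\<close>; either \<open>p = 0\<close> in \<open>S\<close>, or \<open>w t \<ge> 0\<close> bounds the degrees of all powers of \<open>h\<close> below, and then
  \<open>p h\<close> is topologically nilpotent.

  Multiplication of power series is associative because left multiplication \<open>V\<close> by \<open>x\<close> satisfies
  \<open>V (b c) = (V b) c\<close> and double series whose terms tend to \<open>0\<close> uniformly in one index can be exchanged.

  For the natural map, \<open>(x - t) s = \<sigma>(s) (x - t)\<close> yields the commutation rule of \<open>X\<^sub>n\<close> with scalars.
  The same congruence modulo \<open>p\<close> shows that \<open>X\<^sub>n\<close> is \<open>x ^ (p ^ n)\<close> plus terms of value at least \<open>1\<close>, with
  coefficients in a commutative subring fixed by \<open>\<sigma>\<close> and killed by \<open>\<delta>\<close>, where \<open>v\<^bsub>x,\<epsilon>\<^esub>(a b) \<ge> v\<^bsub>x,\<epsilon>\<^esub>(a) + v\<^bsub>x,\<epsilon>\<^esub>(b)\<close>.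
\<close>

section \<open>Iterates of additive maps\<close>

lemma funpow_additive: "additive (f :: 'a::ab_group_add \<Rightarrow> 'a) \<Longrightarrow> additive (f ^^ n)"
  by (induction n) (simp_all add: additive_def)

lemma funpow_commute:
  assumes "f \<circ> g = g \<circ> f"
  shows "f ((g ^^ n) x) = (g ^^ n) (f x)"
proof (induction n)
  case (Suc n)
  then show ?case
    using assms by (simp add: fun_eq_iff)
qed simp

text \<open>Pascal's rule summed against an arbitrary sequence. In this form it is the induction
  step of the binomial theorem for operators.\<close>

lemma sum_atMost_Suc_choose:
  fixes a :: "nat \<Rightarrow> 'a::ring_1"
  shows "(\<Sum>i\<le>Suc n. of_nat (Suc n choose i) * a i) =
    (\<Sum>i\<le>n. of_nat (n choose i) * a i) + (\<Sum>i\<le>n. of_nat (n choose i) * a (Suc i))"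
proof -
  have "(\<Sum>i\<le>Suc n. of_nat (Suc n choose i) * a i) =
      a 0 + (\<Sum>i\<le>n. of_nat (Suc n choose Suc i) * a (Suc i))"
    by (subst sum.atMost_Suc_shift) simp
  also have "(\<Sum>i\<le>n. of_nat (Suc n choose Suc i) * a (Suc i)) =
      (\<Sum>i\<le>n. of_nat (n choose i) * a (Suc i)) + (\<Sum>i\<le>n. of_nat (n choose Suc i) * a (Suc i))"
    by (simp add: distrib_right sum.distrib)
  also have "a 0 + (\<dots>) = (a 0 + (\<Sum>i\<le>n. of_nat (n choose Suc i) * a (Suc i))) +
      (\<Sum>i\<le>n. of_nat (n choose i) * a (Suc i))"
    by (simp add: add_ac)
  also have "a 0 + (\<Sum>i\<le>n. of_nat (n choose Suc i) * a (Suc i)) =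
      (\<Sum>i\<le>Suc n. of_nat (n choose i) * a i)"
    by (subst sum.atMost_Suc_shift) simp
  also have "\<dots> = (\<Sum>i\<le>n. of_nat (n choose i) * a i)"
    by (simp add: binomial_eq_0)
  finally show ?thesis .
qed

lemma additive_of_nat_mult:
  assumes "additive (f :: 'a::ring_1 \<Rightarrow> 'b::ring_1)"
  shows "f (of_nat n * s) = of_nat n * f s"
proof -
  interpret additive f by fact
  show ?thesis
    by (induction n) (simp_all add: zero add distrib_right)
qed

lemma additive_of_int_mult:
  assumes "additive (f :: 'a::ring_1 \<Rightarrow> 'b::ring_1)"
  shows "f (of_int n * s) = of_int n * f s"
proof -
  interpret additive f by fact
  show ?thesis
  proof (cases n)
    case (neg m)
    then show ?thesis
      using minus[of "of_nat (Suc m) * s"] additive_of_nat_mult[OF assms, of "Suc m" s]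
      by (simp del: of_nat_Suc)
  qed (simp add: additive_of_nat_mult[OF assms])
qed

text \<open>Commuting additive maps generate a commutative ring under composition, so the usual
  induction works; additivity lets the binomial coefficients pass through \<open>f\<close> and
  \<open>g\<close>.\<close>

lemma funpow_binomial:
  fixes f g :: "'a::ring_1 \<Rightarrow> 'a"
  assumes f: "additive f" and g: "additive g" and comm: "f \<circ> g = g \<circ> f"
  shows "((\<lambda>s. f s + g s) ^^ n) s = (\<Sum>i\<le>n. of_nat (n choose i) * (f ^^ i) ((g ^^ (n - i)) s))"
proof (induction n)
  case (Suc n)
  have comm': "g ((f ^^ i) s) = (f ^^ i) (g s)" for i s
    by (rule funpow_commute) (simp add: comm)
  let ?a = "\<lambda>i. (f ^^ i) ((g ^^ (Suc n - i)) s)"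
  let ?S = "\<Sum>i\<le>n. of_nat (n choose i) * (f ^^ i) ((g ^^ (n - i)) s)"
  have "f ?S = (\<Sum>i\<le>n. of_nat (n choose i) * ?a (Suc i))"
    by (simp add: additive.sum[OF f] additive_of_nat_mult[OF f])
  moreover have "g ?S = (\<Sum>i\<le>n. of_nat (n choose i) * ?a i)"
    by (simp add: additive.sum[OF g] additive_of_nat_mult[OF g] comm' Suc_diff_le)
  moreover have "((\<lambda>s. f s + g s) ^^ Suc n) s = f ?S + g ?S"
    by (simp add: Suc.IH)
  ultimately show ?case
    using sum_atMost_Suc_choose[of n ?a] by (simp only: add_ac)
qed simp

section \<open>Filtered rings\<close>

text \<open>
  The condition on \<open>w (- 1)\<close> does not follow from \<^const>\<open>ring_filtration\<close>: on the integers, let \<open>w\<close>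
  be \<open>0\<close> at positive and \<open>-1\<close> at negative arguments, and \<open>\<infinity>\<close> at \<open>0\<close>.
\<close>

locale filtered_ring =
  fixes w :: "'a::ring_1 \<Rightarrow> ereal"
  assumes filtration: "ring_filtration w" and minus_one: "0 \<le> w (- 1)"
begin

lemma w_infinity: "w a = \<infinity> \<longleftrightarrow> a = 0"
  using filtration by (simp add: ring_filtration_def)

lemma w_zero [simp]: "w 0 = \<infinity>"
  by (simp add: w_infinity)

lemma w_one [simp]: "w 1 = 0"
  using filtration by (simp add: ring_filtration_def)

lemma w_add: "c \<le> w a \<Longrightarrow> c \<le> w b \<Longrightarrow> c \<le> w (a + b)"
  using filtration unfolding ring_filtration_def by (meson min.boundedI order_trans)

lemma w_mult: "c \<le> w a \<Longrightarrow> d \<le> w b \<Longrightarrow> c + d \<le> w (a * b)"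
  using filtration unfolding ring_filtration_def by (meson add_mono order_trans)

lemma w_minus: "c \<le> w a \<Longrightarrow> c \<le> w (- a)"
  using w_mult[OF minus_one, of c a] by simp

lemma w_diff: "c \<le> w a \<Longrightarrow> c \<le> w b \<Longrightarrow> c \<le> w (a - b)"
  using w_add[OF _ w_minus, of c a b] by simp

lemma w_sum: "(\<And>i. i \<in> I \<Longrightarrow> c \<le> w (f i)) \<Longrightarrow> c \<le> w (sum f I)"
  by (induction I rule: infinite_finite_induct) (auto intro: w_add)

abbreviation lev :: "int \<Rightarrow> 'a \<Rightarrow> bool" where
  "lev k s \<equiv> ereal (of_int k) \<le> w s"

lemma lev_mult: "lev k a \<Longrightarrow> lev m b \<Longrightarrow> lev (k + m) (a * b)"
  using w_mult[of "ereal (of_int k)" a "ereal (of_int m)" b] by simp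

lemma lev_mono: "lev k a \<Longrightarrow> m \<le> k \<Longrightarrow> lev m a"
  by (erule order_trans[rotated]) simp

lemma lev_exists: "\<exists>k. lev k a"
proof (cases "w a = \<infinity>")
  case False
  with filtration obtain k :: int where "w a = ereal (of_int k)"
    unfolding ring_filtration_def by blast
  then show ?thesis by auto
qed auto

text \<open>Finite values are integers, so only \<infinity> exceeds every level. This separatedness
  makes limits unique.\<close>

lemma lev_all_imp_zero: "(\<And>k. lev k a) \<Longrightarrow> a = 0"
proof -
  assume a: "\<And>k. lev k a"
  show "a = 0"
  proof (rule ccontr)
    assume "a \<noteq> 0"
    with filtration obtain k :: int where "w a = ereal (of_int k)"
      unfolding ring_filtration_def by blast
    with a[of "k + 1"] show False by simp
  qed
qed

lemma lev_of_nat: "lev 0 (of_nat n)"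
  by (induction n) (auto intro: w_add)

lemma lev_of_int: "lev 0 (of_int n)"
proof (cases n)
  case (neg m)
  then show ?thesis
    using w_minus[OF lev_of_nat[of "Suc m"]] by (simp del: of_nat_Suc)
qed (simp add: lev_of_nat[simplified])

lemma lev_of_nat_mult: "lev k s \<Longrightarrow> lev k (of_nat n * s)"
  using lev_mult[OF lev_of_nat, of k s n] by simp

lemma lev_power: "lev k s \<Longrightarrow> lev (int n * k) (s ^ n)"
proof (induction n)
  case (Suc n)
  then show ?case
    using lev_mult[of k s "int n * k" "s ^ n"] by (simp add: distrib_right)
qed simp

lemma lev_power_0: "lev 0 s \<Longrightarrow> lev 0 (s ^ n)"
  using lev_power[of 0 s n] by simp

text \<open>Says that the degree is at least \<open>d\<close>. Most arguments use this relation on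
  integer levels, so that suprema in \<open>ereal\<close> appear only in the translation lemmas
  below.\<close>

definition shift :: "('a \<Rightarrow> 'a) \<Rightarrow> int \<Rightarrow> bool" where
  "shift f d \<longleftrightarrow> (\<forall>k s. lev k s \<longrightarrow> lev (k + d) (f s))"

lemma shiftD: "shift f d \<Longrightarrow> lev k s \<Longrightarrow> lev (k + d) (f s)"
  by (simp add: shift_def)

lemma shift_mono: "shift f d \<Longrightarrow> e \<le> d \<Longrightarrow> shift f e"
  unfolding shift_def by (meson add_left_mono lev_mono)

lemma shift_id: "shift id 0"
  by (simp add: shift_def)

lemma shift_comp: "shift f d \<Longrightarrow> shift g e \<Longrightarrow> shift (f \<circ> g) (d + e)"
  using shiftD[of f d "k + e" "g s" for k s] shiftD[of g e]
  unfolding shift_def[of "f \<circ> g"] by (simp add: ac_simps)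

lemma shift_funpow: "shift f d \<Longrightarrow> shift (f ^^ n) (int n * d)"
proof (induction n)
  case 0
  then show ?case using shift_id by (simp add: id_def)
next
  case (Suc n)
  then show ?case using shift_comp[of f d "f ^^ n" "int n * d"]
    by (simp add: algebra_simps comp_def)
qed

lemma shift_diff: "shift f d \<Longrightarrow> shift g d \<Longrightarrow> shift (\<lambda>s. f s - g s) d"
  by (simp add: shift_def w_diff)

lemma shifts_by_iff_shift:
  "shifts_by \<int> UNIV w UNIV w f (of_int d) \<longleftrightarrow> shift f d"
  unfolding shifts_by_def shift_def filt_level_def Ints_def by auto

lemma filtered_endo_iff: "filtered_endo w f \<longleftrightarrow> (\<exists>d. shift f d)"
  unfolding filtered_map_def Ints_def by (simp add: shifts_by_iff_shift[symmetric] Ints_def)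

text \<open>The degree is a supremum over integers, so the bound \<open>B\<close> can be reached
  only if \<open>B\<close> itself is an admissible shift.\<close>

lemma degree_endo_ge_iff: "ereal (of_int B) \<le> degree_endo w f \<longleftrightarrow> shift f B"
proof
  assume "shift f B"
  then show "ereal (of_int B) \<le> degree_endo w f"
    unfolding filt_degree_def
    by (intro Sup_upper CollectI exI[of _ "of_int B"]) (simp add: shifts_by_iff_shift)
next
  assume B: "ereal (of_int B) \<le> degree_endo w f"
  show "shift f B"
  proof (rule ccontr)
    assume f: "\<not> shift f B"
    \<comment> \<open>Admissible shifts are downward closed. If \<open>B\<close> is not one, all of
      them are at most \<open>B - 1\<close>, which leaves a gap of one below \<open>B\<close>; an
      empty set of shifts is covered too.\<close>
    have B': "degree_endo w f \<le> ereal (of_int (B - 1))"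
      unfolding filt_degree_def
    proof (rule Sup_least)
      fix x
      assume "x \<in> {ereal d |d. d \<in> \<int> \<and> shifts_by \<int> UNIV w UNIV w f d}"
      then obtain d :: int where d: "x = ereal (of_int d)" "shift f d"
        by (auto elim!: Ints_cases simp: shifts_by_iff_shift)
      have "\<not> B \<le> d"
        using f shift_mono[OF d(2)] by blast
      then have "d \<le> B - 1"
        by linarith
      then show "x \<le> ereal (of_int (B - 1))"
        unfolding d(1) ereal_less_eq of_int_le_iff .
    qed
    show False
      using order_trans[OF B B'] by simp
  qed
qed

lemma degree_endo_pos_iff: "0 < degree_endo w f \<longleftrightarrow> shift f 1"
proof
  assume "shift f 1"
  then have "ereal (of_int 1) \<le> degree_endo w f"
    by (simp only: degree_endo_ge_iff)
  then show "0 < degree_endo w f"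
    by (rule less_le_trans[rotated]) simp
next
  assume "0 < degree_endo w f"
  then obtain d where "d \<in> \<int>" "shifts_by \<int> UNIV w UNIV w f d" "0 < d"
    unfolding filt_degree_def by (auto simp: less_Sup_iff zero_ereal_def)
  then obtain e :: int where "shift f e" "0 < e"
    by (auto elim!: Ints_cases simp: shifts_by_iff_shift)
  then show "shift f 1"
    by (auto intro: shift_mono)
qed

section \<open>Additive maps with a power of positive degree\<close>

lemma not_shift_id: "\<not> shift id 1"
  using shiftD[of id 1 0 1] by auto

text \<open>Divide \<open>j\<close> by \<open>N\<close> with remainder: each full block
  \<open>f ^^ N\<close> gains at least one level, and the fewer than \<open>N\<close> remaining
  factors lose at most \<open>N * \<bar>e\<bar>\<close> in total. The case \<open>N = 0\<close> is
  excluded because the identity has degree 0.\<close>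

lemma shift_funpow_pos:
  assumes f: "shift f e" and N: "shift (f ^^ N) 1"
  shows "0 < N" and "\<exists>C. \<forall>j. shift (f ^^ j) (C + int (j div N))"
proof -
  show "0 < N"
    using N not_shift_id by (cases N) (auto simp: id_def)
  have "shift (f ^^ j) (- int N * \<bar>e\<bar> + int (j div N))" for j
  proof -
    have "f ^^ j = f ^^ (j mod N) \<circ> (f ^^ N) ^^ (j div N)"
      by (simp add: funpow_mult funpow_add[symmetric])
    moreover have "- (int N * \<bar>e\<bar>) \<le> int (j mod N) * e"
    proof -
      have "int (j mod N) * (- e) \<le> int (j mod N) * \<bar>e\<bar>"
        by (intro mult_left_mono) auto
      also have "\<dots> \<le> int N * \<bar>e\<bar>"
        using \<open>0 < N\<close> by (intro mult_right_mono) (auto simp: order.strict_implies_order)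
      finally show ?thesis by simp
    qed
    ultimately show ?thesis
      using shift_comp[OF shift_funpow[OF f, of "j mod N"] shift_funpow[OF N, of "j div N"]]
      by (auto elim!: shift_mono)
  qed
  then show "\<exists>C. \<forall>j. shift (f ^^ j) (C + int (j div N))"
    by blast
qed

text \<open>Once all integer powers of \<open>\<tau>\<close> share a degree bound, a power of
  \<open>d\<close> of positive degree bounds all powers of \<open>d\<close> below, and the two
  bounds add up to the common bound of the definition.\<close>

lemma quasi_compatible_iff:
  assumes comm: "commuting_skew_derivation \<tau> d"
    and tau: "\<And>i. shift (int_funpow \<tau> i) D" and d: "shift d e"
  shows "quasi_compatible w \<tau> d \<longleftrightarrow> (\<exists>N. shift (d ^^ N) 1)"
proof
  assume "\<exists>N. shift (d ^^ N) 1"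
  then obtain N where N: "shift (d ^^ N) 1" ..
  then obtain C where C: "\<And>j. shift (d ^^ j) (C + int (j div N))"
    using shift_funpow_pos[OF d] by blast
  have "shift (int_funpow \<tau> i \<circ> d ^^ j) (D + C)" for i j
    by (rule shift_mono[OF shift_comp[OF tau C]]) simp
  moreover have "filtered_endo w \<tau>" "filtered_endo w (inv_into UNIV \<tau>)" "filtered_endo w d"
    using tau[of 1] tau[of "-1"] d unfolding filtered_endo_iff int_funpow_def by auto
  ultimately show "quasi_compatible w \<tau> d"
    using comm N unfolding quasi_compatible_def degree_endo_ge_iff degree_endo_pos_iff by blast
qed (auto simp: quasi_compatible_def degree_endo_pos_iff)

text \<open>Upgrades the constant lower bound of the definition to one that grows linearly in
  \<open>i\<close>, uniformly in \<open>e\<close>. This growth makes the series in the product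
  formula converge.\<close>

lemma quasi_compatible_shift:
  assumes "quasi_compatible w \<tau> d"
  shows "\<exists>B N. 0 < N \<and> (\<forall>e i. shift (\<tau> ^^ e \<circ> d ^^ i) (B + int (i div N)))"
proof -
  from assms obtain B N where B: "\<And>i j. shift (int_funpow \<tau> i \<circ> d ^^ j) B"
    and N: "shift (d ^^ N) 1"
    unfolding quasi_compatible_def degree_endo_ge_iff degree_endo_pos_iff by blast
  have "shift d B"
    using B[of 0 1] by (simp add: int_funpow_def)
  then have "0 < N"
    using N by (rule shift_funpow_pos)
  moreover have "shift (\<tau> ^^ e \<circ> d ^^ i) (B + int (i div N))" for e i
  proof -
    have "d ^^ i = d ^^ (i mod N) \<circ> (d ^^ N) ^^ (i div N)"
      by (simp add: funpow_mult funpow_add[symmetric])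
    then show ?thesis
      using shift_comp[OF B[of "int e" "i mod N"] shift_funpow[OF N, of "i div N"]]
      by (simp add: int_funpow_def o_assoc)
  qed
  ultimately show ?thesis
    by blast
qed

text \<open>In the binomial expansion of a high power, every term contains either many factors
  \<open>f\<close> or many factors \<open>c\<close>, and both raise the level. The powers of
  \<open>h\<close> cost at most the fixed amount \<open>D\<close>.\<close>

lemma nilpotent_perturb:
  assumes f: "additive f" "shift f e" and h: "additive h" "\<And>i. shift (h ^^ i) D"
    and comm: "f \<circ> h = h \<circ> f" and c: "lev 1 (of_nat c)"
    and nil: "\<exists>N. shift (f ^^ N) 1"
  shows "\<exists>N. shift ((\<lambda>s. f s + of_nat c * h s) ^^ N) 1"
proof -
  obtain N where N: "shift (f ^^ N) 1"
    using nil ..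
  then obtain C where N0: "0 < N" and C: "\<And>j. shift (f ^^ j) (C + int (j div N))"
    using shift_funpow_pos[OF f(2)] by blast
  let ?h = "\<lambda>s. of_nat c * h s"
  have h': "(?h ^^ j) s = of_nat c ^ j * (h ^^ j) s" for j s
  proof (induction j)
    case (Suc j)
    then show ?case
      using additive_of_nat_mult[OF h(1), of "c ^ j"] by (simp add: mult.assoc)
  qed simp
  have hshift: "shift (?h ^^ j) (int j + D)" for j
    unfolding shift_def h'
  proof (intro allI impI)
    fix k s
    assume "lev k s"
    then have "lev (int j * 1 + (k + D)) (of_nat c ^ j * (h ^^ j) s)"
      by (intro lev_mult lev_power c shiftD[OF h(2)])
    then show "lev (k + (int j + D)) (of_nat c ^ j * (h ^^ j) s)"
      by (simp add: algebra_simps)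
  qed
  have add_h: "additive ?h"
    using h(1) by (simp add: additive_def distrib_left)
  have comm': "f \<circ> ?h = ?h \<circ> f"
    using additive_of_nat_mult[OF f(1)] comm by (simp add: fun_eq_iff)
  \<comment> \<open>Chosen so that \<open>K div N\<close> exceeds the possible losses
    \<open>C\<close> and \<open>D\<close> by at least one. Since \<open>i div N + (K - i)\<close> is
    never below \<open>K div N\<close>, every term of the expansion gains a level.\<close>
  define K where "K = N * nat (1 + \<bar>C\<bar> + \<bar>D\<bar>)"
  have "shift ((\<lambda>s. f s + ?h s) ^^ K) 1"
    unfolding shift_def funpow_binomial[OF f(1) add_h comm']
  proof (intro allI impI w_sum lev_of_nat_mult)
    fix k s i
    assume s: "lev k s" and i: "i \<in> {..K}"
    have "K div N = nat (1 + \<bar>C\<bar> + \<bar>D\<bar>)"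
      using N0 by (simp add: K_def)
    moreover have "(i + m) div N \<le> i div N + m" for m
    proof -
      have "i + m \<le> i + m * N" using N0 by simp
      then have "(i + m) div N \<le> (i + m * N) div N" by (rule div_le_mono)
      also have "\<dots> = i div N + m" using N0 by simp
      finally show ?thesis .
    qed
    from this[of "K - i"] have "K div N \<le> i div N + (K - i)" using i by simp
    ultimately have "1 \<le> int (K - i) + D + (C + int (i div N))"
      by linarith
    moreover have "lev (k + (int (K - i) + D) + (C + int (i div N))) ((f ^^ i) ((?h ^^ (K - i)) s))"
      using s by (intro shiftD[OF C] shiftD[OF hshift])
    ultimately show "lev (k + 1) ((f ^^ i) ((?h ^^ (K - i)) s))"
      by (elim lev_mono) simp
  qed
  then show ?thesis ..
qed

end

section \<open>Inner skew derivations and Frobenius powers\<close>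

text \<open>From \<open>j * (q choose j) = q * (q - 1 choose (j - 1))\<close> with
  \<open>q = p ^ n\<close>: were the binomial coefficient prime to \<open>p\<close>, then
  \<open>q\<close> would divide \<open>j < q\<close>.\<close>

lemma dvd_choose_prime_power:
  fixes p :: nat
  assumes "prime p" "0 < j" "j < p ^ n"
  shows "p dvd p ^ n choose j"
proof (rule ccontr)
  assume "\<not> p dvd p ^ n choose j"
  then have "coprime (p ^ n) (p ^ n choose j)"
    using assms(1) prime_imp_coprime by (intro coprime_power_left_iff[THEN iffD2]) blast
  moreover have "p ^ n dvd j * (p ^ n choose j)"
    using times_binomial_minus1_eq[OF \<open>0 < j\<close>, of "p ^ n"] by simp
  ultimately have "p ^ n dvd j"
    using coprime_dvd_mult_left_iff by blast
  with assms show False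
    by (meson dvd_imp_le leD)
qed

text \<open>The reason for the sign in \<open>Tn\<close>: it is 1 for odd \<open>p\<close> and -1
  for \<open>p = 2\<close>, hence congruent to 1 and opposite to the sign of
  \<open>(- t) ^ (p ^ n)\<close> modulo \<open>p\<close>.\<close>

lemma minus_one_power_prime_power:
  fixes p :: nat
  assumes "prime p"
  shows "int p dvd (- 1) ^ (p + 1) - 1" "int p dvd (- 1) ^ (p + 1) + (- 1) ^ (p ^ n)"
proof -
  show "int p dvd (- 1) ^ (p + 1) - 1"
    using prime_odd_nat[OF assms] prime_ge_2_nat[OF assms]
    by (cases "p = 2") (auto simp: le_less)
  show "int p dvd (- 1) ^ (p + 1) + (- 1) ^ (p ^ n)"
  proof (cases "p = 2")
    case True
    then show ?thesis by (cases "n = 0") auto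
  next
    case False
    then show ?thesis
      using prime_odd_nat[OF assms] prime_ge_2_nat[OF assms] by (simp add: le_less)
  qed
qed

lemma skew_derivation_iff:
  "skew_derivation \<sigma> \<delta> \<longleftrightarrow>
     bij \<sigma> \<and> \<sigma> 1 = 1 \<and> (\<forall>r s. \<sigma> (r + s) = \<sigma> r + \<sigma> s) \<and> (\<forall>r s. \<sigma> (r * s) = \<sigma> r * \<sigma> s) \<and>
     (\<forall>r s. \<delta> (r + s) = \<delta> r + \<delta> s) \<and> (\<forall>r s. \<delta> (r * s) = \<delta> r * s + \<sigma> r * \<delta> s)"
  unfolding skew_derivation_def ring_iso_def ring_hom_def ring_of_type_algebra_def by auto

text \<open>Lets a degree bound for all integer powers of \<sigma> serve for all integer powers of
  \<open>\<sigma> ^^ q\<close> as well.\<close>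

lemma int_funpow_funpow:
  assumes "bij \<sigma>"
  shows "int_funpow (\<sigma> ^^ q) i = int_funpow \<sigma> (int q * i)"
proof (cases "0 \<le> i")
  case True
  then show ?thesis
    by (simp add: int_funpow_def funpow_mult nat_mult_distrib)
next
  case False
  have "inv_into UNIV (\<sigma> ^^ q) = inv_into UNIV \<sigma> ^^ q"
    by (rule inv_fn[OF assms])
  moreover have "0 \<le> int q * i \<longleftrightarrow> q = 0"
    using False by (simp add: zero_le_mult_iff)
  ultimately show ?thesis
    using False nat_mult_distrib[of "int q" "- i"] by (auto simp: int_funpow_def funpow_mult)
qed

context filtered_ring
begin

text \<open>A bijective strictly filtered map carries each level set onto itself, so it is an
  isometry.\<close>

lemma strictly_filtered_imp_lev_iff:
  assumes "bij f" "strictly_filtered_endo w f"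
  shows "lev k (f s) \<longleftrightarrow> lev k s"
proof -
  have "f ` {a. lev k a} = {a. lev k a}"
    using assms bij_is_surj[OF assms(1)]
    unfolding strictly_filtered_map_def filt_level_def Ints_def by auto
  then show ?thesis
    using bij_is_inj[OF assms(1)] by (metis (no_types, lifting) inj_image_mem_iff mem_Collect_eq)
qed

text \<open>Powers of \<open>\<sigma> ^^ P\<close> are isometries, so any integer exponent can be
  moved into the range from 0 to \<open>P\<close>. This also controls the inverse, about which
  nothing is assumed.\<close>

lemma int_funpow_shift_bounded:
  assumes bij: "bij \<sigma>" and d: "shift \<sigma> d" and "0 < P" "strictly_filtered_endo w (\<sigma> ^^ P)"
  shows "\<exists>D. \<forall>i. shift (int_funpow \<sigma> i) D"
proof -
  define D where "D = - (int P * \<bar>d\<bar>)"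
  have low: "shift (\<sigma> ^^ r) D" if "r \<le> P" for r
  proof -
    have "int r * (- d) \<le> int r * \<bar>d\<bar>"
      by (intro mult_left_mono) auto
    also have "\<dots> \<le> int P * \<bar>d\<bar>"
      using that by (intro mult_right_mono) auto
    finally show ?thesis
      using shift_mono[OF shift_funpow[OF d, of r], of D] by (simp add: D_def)
  qed
  have P: "lev k (((\<sigma> ^^ P) ^^ c) s) \<longleftrightarrow> lev k s" for k c s
    by (induction c) (simp_all add: strictly_filtered_imp_lev_iff[OF bij_fn[OF bij] assms(4)])
  have "lev (k + D) (int_funpow \<sigma> i s)" if s: "lev k s" for i k s
  proof (cases "0 \<le> i")
    case True
    have "\<sigma> ^^ nat i = \<sigma> ^^ (nat i mod P) \<circ> (\<sigma> ^^ P) ^^ (nat i div P)"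
      by (simp add: funpow_mult funpow_add[symmetric])
    moreover have "lev (k + D) ((\<sigma> ^^ (nat i mod P)) (((\<sigma> ^^ P) ^^ (nat i div P)) s))"
      using \<open>0 < P\<close> s P by (intro shiftD[OF low]) (auto simp: less_imp_le)
    ultimately show ?thesis
      using True by (simp add: int_funpow_def)
  next
    case False
    define m where "m = nat (- i)"
    \<comment> \<open>Rounds up: \<open>c * P\<close> lies above \<open>m\<close> by some
      \<open>r\<close> with \<open>0 < r\<close> and \<open>r \<le> P\<close>, so \<sigma> only has
      to be applied \<open>r\<close> times in the forward direction.\<close>
    define c where "c = Suc (m div P)"
    define r where "r = c * P - m"
    define z where "z = (inv_into UNIV \<sigma> ^^ m) s"
    have "m < c * P"
      using dividend_less_div_times[OF \<open>0 < P\<close>, of m] by (simp add: c_def add.commute)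
    moreover obtain c' where "c = Suc c'" "c' * P \<le> m"
      using that[of "m div P"] by (simp add: c_def)
    ultimately have r: "r \<le> P" "r + m = P * c"
      unfolding r_def by (simp_all add: algebra_simps)
    have "(\<sigma> ^^ m) z = s"
      unfolding z_def inv_fn[OF bij, symmetric] by (simp add: bij_fn[OF bij] bij_is_surj surj_f_inv_f)
    \<comment> \<open>The right side has the same level as \<open>z\<close>, and the left side is
      bounded by \<open>low\<close>.\<close>
    then have "(\<sigma> ^^ r) s = ((\<sigma> ^^ P) ^^ c) z"
      using r(2) by (metis comp_apply funpow_add funpow_mult)
    then have "lev (k + D) z"
      using P[of "k + D"] shiftD[OF low[OF r(1)] s] by simp
    then show ?thesis
      using False by (simp add: int_funpow_def z_def m_def)
  qed
  then show ?thesis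
    unfolding shift_def by blast
qed

end

text \<open>The hypothesis on a strictly filtered power of \<sigma> enters through \<open>D\<close>,
  a common lower bound for the degrees of all integer powers of \<sigma>.\<close>

locale inner_skew_derivation = filtered_ring w for w :: "'a::ring_1 \<Rightarrow> ereal" +
  fixes \<sigma> \<delta> :: "'a \<Rightarrow> 'a" and t :: 'a and p :: nat and D :: int
  assumes prime_p: "prime p"
    and sigma_bij: "bij \<sigma>"
    and sigma_one: "\<sigma> 1 = 1"
    and sigma_add: "\<sigma> (r + s) = \<sigma> r + \<sigma> s"
    and sigma_mult: "\<sigma> (r * s) = \<sigma> r * \<sigma> s"
    and sigma_shift: "shift (int_funpow \<sigma> i) D"
    and sigma_t: "\<sigma> t = t"
    and delta: "\<delta> s = t * s - \<sigma> s * t"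
    and lev_p: "lev 1 (of_nat p)"
    and lev_t: "of_nat p \<noteq> (0::'a) \<Longrightarrow> lev 0 t"
begin

definition Tn :: "nat \<Rightarrow> 'a" where
  "Tn n = (- 1) ^ (p + 1) * t ^ (p ^ n)"

definition Sign :: "nat \<Rightarrow> 'a \<Rightarrow> 'a" where
  "Sign n = \<sigma> ^^ (p ^ n)"

definition Deln :: "nat \<Rightarrow> 'a \<Rightarrow> 'a" where
  "Deln n s = Tn n * s - Sign n s * Tn n"

lemma q_pos: "0 < p ^ n"
  using prime_p by (simp add: prime_gt_0_nat)

lemma D_nonpos: "D \<le> 0"
  using sigma_shift[of 0] not_shift_id shift_mono[of id D 1]
  by (force simp: int_funpow_def id_def)

lemma sigma_pow_shift: "shift (\<sigma> ^^ b) D"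
  using sigma_shift[of "int b"] by (simp add: int_funpow_def)

lemma sigma_pow_additive: "additive (\<sigma> ^^ b)"
  using sigma_add by (intro funpow_additive) (simp add: additive_def)

lemma sigma_pow_one: "(\<sigma> ^^ b) 1 = 1"
  by (induction b) (simp_all add: sigma_one)

lemma sigma_pow_mult: "(\<sigma> ^^ b) (r * s) = (\<sigma> ^^ b) r * (\<sigma> ^^ b) s"
  by (induction b) (simp_all add: sigma_mult)

lemma sigma_pow_t: "(\<sigma> ^^ b) (t ^ c) = t ^ c"
proof -
  have "(\<sigma> ^^ b) t = t"
    by (induction b) (simp_all add: sigma_t)
  then show ?thesis
    by (induction c) (simp_all add: sigma_pow_one sigma_pow_mult)
qed

lemma Tn_eq: "Tn n = of_int ((- 1) ^ (p + 1)) * t ^ (p ^ n)"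
  by (simp add: Tn_def)

lemma sigma_pow_Tn: "(\<sigma> ^^ b) (Tn n) = Tn n"
  unfolding Tn_eq additive_of_int_mult[OF sigma_pow_additive] sigma_pow_t ..

lemma Deln_shift: "\<exists>e. shift (Deln n) e"
proof -
  obtain k where k: "lev k (Tn n)"
    using lev_exists by blast
  have "lev (m + (k + D)) (Deln n s)" if s: "lev m s" for m s
  proof -
    have "lev (k + m) (Tn n * s)" "lev (m + D + k) (Sign n s * Tn n)"
      using k s by (auto simp only: Sign_def intro!: lev_mult shiftD[OF sigma_pow_shift])
    then show ?thesis
      unfolding Deln_def using D_nonpos by (intro w_diff) (erule lev_mono, simp)+
  qed
  then show ?thesis
    unfolding shift_def by blast
qed

lemma Deln_additive: "additive (Deln n)"
  by (simp add: additive_def Deln_def Sign_def additive.add[OF sigma_pow_additive] algebra_simps)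

lemma Deln_commuting_skew_derivation: "commuting_skew_derivation (Sign n) (Deln n)"
proof -
  have "bij (Sign n)"
    unfolding Sign_def by (rule bij_fn[OF sigma_bij])
  moreover have "Sign n (Deln n s) = Deln n (Sign n s)" for s
    by (simp add: Deln_def Sign_def additive.diff[OF sigma_pow_additive] sigma_pow_mult sigma_pow_Tn)
  ultimately show ?thesis
    unfolding commuting_skew_derivation_def skew_derivation_iff
    by (auto simp: Sign_def sigma_pow_one sigma_pow_mult additive.add[OF sigma_pow_additive]
        additive.add[OF Deln_additive]) (simp_all add: Deln_def Sign_def sigma_pow_mult algebra_simps)
qed

text \<open>
  The additive group generated by the operators \<open>s \<mapsto> t\<^sup>a \<sigma>\<^sup>b(s) t\<^sup>b\<close> is a commutative ring under composition;
  it contains \<open>\<delta>\<close> and all \<open>Deln n\<close>, and if \<open>w t \<ge> 0\<close> its elements are uniformly filtered.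
\<close>

inductive monops :: "('a \<Rightarrow> 'a) \<Rightarrow> bool" where
  monop: "monops (\<lambda>s. t ^ a * (\<sigma> ^^ b) s * t ^ b)"
| diff: "monops f \<Longrightarrow> monops g \<Longrightarrow> monops (\<lambda>s. f s - g s)"

lemma monops_additive: "monops f \<Longrightarrow> additive f"
  by (induction rule: monops.induct)
    (simp_all add: additive_def additive.add[OF sigma_pow_additive] algebra_simps)

lemma monops_zero: "monops (\<lambda>s. 0)"
  using monops.diff[OF monop monop, of 0 0 0 0] by simp

lemma monops_minus: "monops f \<Longrightarrow> monops (\<lambda>s. - f s)"
  using monops.diff[OF monops_zero] by simp

lemma monops_add: "monops f \<Longrightarrow> monops g \<Longrightarrow> monops (\<lambda>s. f s + g s)"
  using monops.diff[OF _ monops_minus, of f g] by simp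

lemma monops_sum: "(\<And>i. i \<in> I \<Longrightarrow> monops (f i)) \<Longrightarrow> monops (\<lambda>s. \<Sum>i\<in>I. f i s)"
  by (induction I rule: infinite_finite_induct) (auto intro: monops_add monops_zero)

lemma monops_of_nat: "monops f \<Longrightarrow> monops (\<lambda>s. of_nat n * f s)"
  by (induction n) (auto intro: monops_add monops_zero simp: distrib_right)

lemma monops_of_int:
  assumes "monops f"
  shows "monops (\<lambda>s. of_int n * f s)"
proof (cases n)
  case (neg m)
  then show ?thesis
    using monops_minus[OF monops_of_nat[OF assms, of "Suc m"]] by (simp del: of_nat_Suc)
qed (simp add: monops_of_nat assms)

text \<open>As \<sigma> fixes \<open>t\<close>, composing two generators just adds their exponents,
  which yields closure under composition.\<close>

lemma monop_comp: "monops f \<Longrightarrow> monops (\<lambda>s. t ^ a * (\<sigma> ^^ b) (f s) * t ^ b)"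
proof (induction rule: monops.induct)
  case (monop c d)
  have "t ^ (b + d) = t ^ d * t ^ b"
    by (simp add: add.commute flip: power_add)
  then have "(\<lambda>s. t ^ a * (\<sigma> ^^ b) (t ^ c * (\<sigma> ^^ d) s * t ^ d) * t ^ b) =
      (\<lambda>s. t ^ (a + c) * (\<sigma> ^^ (b + d)) s * t ^ (b + d))"
    by (simp add: sigma_pow_mult sigma_pow_t funpow_add power_add[of t a c] mult.assoc)
  then show ?case
    using monops.monop by simp
next
  case (diff f g)
  then show ?case
    using monops.diff[OF diff.IH] by (simp add: additive.diff[OF sigma_pow_additive] algebra_simps)
qed

lemma monops_comp: "monops f \<Longrightarrow> monops g \<Longrightarrow> monops (\<lambda>s. f (g s))"
  by (induction rule: monops.induct) (auto intro: monop_comp monops.diff)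

lemma monop_commute: "monops f \<Longrightarrow> f (t ^ a * (\<sigma> ^^ b) s * t ^ b) = t ^ a * (\<sigma> ^^ b) (f s) * t ^ b"
proof (induction rule: monops.induct)
  case (monop c d)
  have "(\<sigma> ^^ d) ((\<sigma> ^^ b) s) = (\<sigma> ^^ b) ((\<sigma> ^^ d) s)"
    by (metis add.commute comp_apply funpow_add)
  moreover have "t ^ c * (t ^ a * y) = t ^ a * (t ^ c * y)" "t ^ b * t ^ d = t ^ d * t ^ b" for y
    by (simp_all add: mult.assoc[symmetric] power_add[symmetric] add.commute)
  ultimately show ?case
    by (simp add: sigma_pow_mult sigma_pow_t mult.assoc)
next
  case (diff f g)
  then show ?case
    by (simp add: additive.diff[OF sigma_pow_additive] algebra_simps)
qed

lemma monops_commute: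
  assumes "monops f" "monops g"
  shows "f (g s) = g (f s)"
  using assms(2)
proof (induction arbitrary: s rule: monops.induct)
  case (monop a b)
  then show ?case by (rule monop_commute[OF assms(1)])
next
  case (diff g h)
  then show ?case
    by (simp add: additive.diff[OF monops_additive[OF assms(1)]])
qed

lemma monops_funpow: "monops f \<Longrightarrow> monops (f ^^ n)"
proof (induction n)
  case 0
  then show ?case
    using monop[of 0 0] by (simp add: id_def)
next
  case (Suc n)
  then show ?case
    using monops_comp[of f "f ^^ n"] by (simp add: comp_def)
qed

text \<open>Powers of \<open>t\<close> have level 0 and differences lose nothing, so the bound does
  not depend on \<open>f\<close>; it therefore holds for all iterates of one operator at
  once.\<close>

lemma monops_shift:
  assumes t: "lev 0 t" and "monops f"
  shows "shift f D"
  using assms(2)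
proof (induction rule: monops.induct)
  case (monop a b)
  show ?case
    unfolding shift_def
  proof (intro allI impI)
    fix k s
    assume "lev k s"
    then have "lev (0 + (k + D) + 0) (t ^ a * (\<sigma> ^^ b) s * t ^ b)"
      by (intro lev_mult lev_power_0 t shiftD[OF sigma_pow_shift])
    then show "lev (k + D) (t ^ a * (\<sigma> ^^ b) s * t ^ b)"
      by simp
  qed
qed (rule shift_diff)

section \<open>Comparison of \<open>Deln n\<close> with the power
  \<open>\<delta> ^^ (p ^ n)\<close>\<close>

lemma monops_delta: "monops \<delta>"
  using monops.diff[OF monop[of 1 0] monop[of 0 1]] by (simp add: delta[abs_def])

lemma monops_Deln: "monops (Deln n)"
proof -
  have "monops (\<lambda>s. of_int ((- 1) ^ (p + 1)) *
      (t ^ (p ^ n) * (\<sigma> ^^ 0) s * t ^ 0 - t ^ 0 * (\<sigma> ^^ (p ^ n)) s * t ^ (p ^ n)))"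
    by (intro monops_of_int monops.diff monop)
  moreover have "x * (of_int c * y) = of_int c * (x * y)" for x y :: 'a and c
    by (metis mult.assoc mult_of_int_commute)
  ultimately show ?thesis
    unfolding Deln_def[abs_def] Sign_def Tn_eq
    by (simp add: right_diff_distrib mult.assoc del: of_int_power of_int_minus of_int_1)
qed

text \<open>The binomial theorem for \<open>t * s\<close> and \<open>- (\<sigma> s * t)\<close>,
  which commute because \<sigma> fixes \<open>t\<close>.\<close>

lemma delta_funpow:
  "(\<delta> ^^ m) s =
     (\<Sum>i\<le>m. of_int (int (m choose i) * (- 1) ^ (m - i)) * (t ^ i * (\<sigma> ^^ (m - i)) s * t ^ (m - i)))"
proof -
  let ?f = "\<lambda>s. t * s" and ?g = "\<lambda>s. - (\<sigma> s * t)"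
  have f: "(?f ^^ i) s = t ^ i * s" for i s
    by (induction i) (simp_all add: mult.assoc)
  have g: "(?g ^^ i) s = (- 1) ^ i * ((\<sigma> ^^ i) s * t ^ i)" for i s
  proof (induction i)
    case (Suc i)
    have "\<sigma> ((- 1) ^ i * ((\<sigma> ^^ i) s * t ^ i)) = (- 1) ^ i * (\<sigma> ((\<sigma> ^^ i) s) * t ^ i)"
      using additive_of_int_mult[OF sigma_pow_additive[of 1], of "(- 1) ^ i" "(\<sigma> ^^ i) s * t ^ i"]
        sigma_pow_t[of 1 i] by (simp add: sigma_mult)
    then show ?case
      by (simp add: Suc.IH mult.assoc power_commutes)
  qed simp
  have "additive ?f" "additive ?g" "?f \<circ> ?g = ?g \<circ> ?f"
    by (auto simp: additive_def sigma_add sigma_mult sigma_t algebra_simps)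
  from funpow_binomial[OF this, of m s]
  have "(\<delta> ^^ m) s = (\<Sum>i\<le>m. of_nat (m choose i) * (t ^ i * ((- 1) ^ (m - i) * ((\<sigma> ^^ (m - i)) s * t ^ (m - i)))))"
    by (simp add: f g delta[abs_def])
  moreover have "t ^ i * ((- 1) ^ j * x) = (- 1) ^ j * (t ^ i * x)" for i j x
    by (cases "even j") auto
  ultimately show ?thesis
    by (simp add: mult.assoc)
qed

text \<open>In the expansion of \<open>\<delta> ^^ (p ^ n)\<close> the inner binomial coefficients
  are divisible by \<open>p\<close>, and the two outer terms have the coefficients of
  \<open>Deln n\<close> modulo \<open>p\<close>.\<close>

lemma Deln_eq: "\<exists>h. monops h \<and> (\<forall>s. Deln n s = (\<delta> ^^ (p ^ n)) s + of_nat p * h s)"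
proof -
  let ?q = "p ^ n"
  let ?e = "(- 1) ^ (p + 1) :: int"
  let ?M = "\<lambda>i s. t ^ i * (\<sigma> ^^ (?q - i)) s * t ^ (?q - i)"
  let ?c = "\<lambda>i. int (?q choose i) * (- 1) ^ (?q - i)"
  obtain c where c: "?e - 1 = int p * c"
    using minus_one_power_prime_power(1)[OF prime_p] by blast
  obtain d where d: "?e + (- 1) ^ ?q = int p * d"
    using minus_one_power_prime_power(2)[OF prime_p] by blast
  define b where "b i = ?c i div int p" for i
  have b: "?c i = int p * b i" if "i \<in> {1..<?q}" for i
    unfolding b_def using dvd_choose_prime_power[OF prime_p, of i n] that
    by (intro dvd_mult_div_cancel[symmetric] dvd_mult2) auto
  \<comment> \<open>Collects the quotients by \<open>p\<close> of the three discrepancies: the term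
    with \<open>i = p ^ n\<close>, the term with \<open>i = 0\<close>, and the inner terms.\<close>
  define h where "h s = of_int c * ?M ?q s - of_int d * ?M 0 s - (\<Sum>i\<in>{1..<?q}. of_int (b i) * ?M i s)" for s
  have "monops h"
    unfolding h_def[abs_def] by (intro monops.diff monops_of_int monops_sum monop)
  moreover have "Deln n s = (\<delta> ^^ ?q) s + of_nat p * h s" for s
  proof -
    have "{..?q} = insert 0 (insert ?q {1..<?q})" "?q \<noteq> 0"
      using q_pos[of n] by auto
    then have "(\<delta> ^^ ?q) s = of_int ((- 1) ^ ?q) * ?M 0 s + (of_int 1 * ?M ?q s + (\<Sum>i\<in>{1..<?q}. of_int (?c i) * ?M i s))"
      unfolding delta_funpow by (subst \<open>{..?q} = _\<close>, subst sum.insert, simp, simp, subst sum.insert) simp_all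
    also have "(\<Sum>i\<in>{1..<?q}. of_int (?c i) * ?M i s) = of_int (int p) * (\<Sum>i\<in>{1..<?q}. of_int (b i) * ?M i s)"
      unfolding sum_distrib_left
      by (intro sum.cong refl) (simp only: b of_int_mult mult.assoc)
    also have "of_int ((- 1) ^ ?q) * ?M 0 s = of_int (int p * d) * ?M 0 s - of_int ?e * ?M 0 s"
      unfolding d[symmetric] by (simp add: algebra_simps)
    also have "of_int 1 * ?M ?q s = of_int ?e * ?M ?q s - of_int (int p * c) * ?M ?q s"
      unfolding c[symmetric] by (simp add: algebra_simps)
    finally have "(\<delta> ^^ ?q) s + of_nat p * h s = of_int ?e * ?M ?q s - of_int ?e * ?M 0 s"
      unfolding h_def right_diff_distrib of_int_mult of_int_of_nat_eq mult.assoc by simp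
    moreover have "(\<sigma> ^^ ?q) s * (of_int ?e * t ^ ?q) = of_int ?e * ((\<sigma> ^^ ?q) s * t ^ ?q)"
      by (metis mult.assoc mult_of_int_commute)
    ultimately show ?thesis
      unfolding Deln_def Sign_def Tn_eq by (simp add: mult.assoc del: of_int_power of_int_minus of_int_1)
  qed
  ultimately show ?thesis by blast
qed

lemma delta_shift: "\<exists>e. shift \<delta> e"
proof -
  obtain k where k: "lev k t"
    using lev_exists by blast
  have "lev (m + (k + D)) (\<delta> s)" if s: "lev m s" for m s
  proof -
    have "lev (k + m) (t * s)" "lev (m + D + k) (\<sigma> s * t)"
      using k s shiftD[OF sigma_pow_shift[of 1] s] by (auto simp only: intro!: lev_mult) simp
    then show ?thesis
      unfolding delta using D_nonpos by (intro w_diff) (erule lev_mono, simp)+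
  qed
  then show ?thesis
    unfolding shift_def by blast
qed

text \<open>If \<open>p\<close> vanishes in the ring there is no perturbation; otherwise
  \<open>w t\<close> is non-negative and the iterates of \<open>h\<close> are uniformly
  filtered.\<close>

lemma monops_perturb:
  assumes f: "monops f" "shift f e" and h: "monops h"
    and nil: "\<exists>N. shift (f ^^ N) 1"
  shows "\<exists>N. shift ((\<lambda>s. f s + of_nat p * h s) ^^ N) 1"
proof (cases "of_nat p = (0::'a)")
  case True
  then show ?thesis
    using nil by simp
next
  case False
  show ?thesis
  proof (rule nilpotent_perturb[OF monops_additive[OF f(1)] f(2) monops_additive[OF h] _ _ lev_p nil])
    show "shift (h ^^ i) D" for i
      using monops_shift[OF lev_t[OF False] monops_funpow[OF h]] .
    show "f \<circ> h = h \<circ> f"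
      using monops_commute[OF f(1) h] by auto
  qed
qed

text \<open>Being equal up to \<open>p\<close> times an operator is symmetric, so the perturbation
  argument runs with \<open>h\<close> one way and with \<open>- h\<close> the other; iterates of
  \<open>\<delta> ^^ (p ^ n)\<close> are iterates of \<delta>.\<close>

lemma Deln_nilpotent_iff: "(\<exists>N. shift (Deln n ^^ N) 1) \<longleftrightarrow> (\<exists>N. shift (\<delta> ^^ N) 1)"
proof -
  let ?q = "p ^ n"
  obtain h where h: "monops h" and eq: "\<And>s. Deln n s = (\<delta> ^^ ?q) s + of_nat p * h s"
    using Deln_eq by blast
  obtain e where e: "shift (Deln n) e"
    using Deln_shift by blast
  obtain e' where e': "shift (\<delta> ^^ ?q) e'"
    using delta_shift shift_funpow by blast
  show ?thesis
  proof
    assume "\<exists>N. shift (Deln n ^^ N) 1"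
    from monops_perturb[OF monops_Deln e monops_minus[OF h] this]
    obtain N where "shift ((\<lambda>s. Deln n s + of_nat p * - h s) ^^ N) 1" ..
    also have "(\<lambda>s. Deln n s + of_nat p * - h s) = \<delta> ^^ ?q"
      by (simp add: eq)
    finally show "\<exists>N. shift (\<delta> ^^ N) 1"
      unfolding funpow_mult by blast
  next
    assume "\<exists>N. shift (\<delta> ^^ N) 1"
    then obtain N where "shift (\<delta> ^^ N) 1" ..
    from shift_funpow[OF this, of ?q] have "shift ((\<delta> ^^ ?q) ^^ N) 1"
      unfolding funpow_mult using q_pos[of n] by (auto simp: mult.commute elim!: shift_mono)
    from monops_perturb[OF monops_funpow[OF monops_delta] e' h exI, OF this]
    show "\<exists>N. shift (Deln n ^^ N) 1"
      by (simp add: eq[abs_def])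
  qed
qed

lemma delta_commuting_skew_derivation: "commuting_skew_derivation \<sigma> \<delta>"
  unfolding commuting_skew_derivation_def skew_derivation_iff
  by (auto simp: sigma_bij sigma_one sigma_add sigma_mult delta additive.diff[OF sigma_pow_additive[of 1, simplified]]
      sigma_t algebra_simps)

theorem quasi_compatible_Deln_iff:
  "quasi_compatible w (Sign n) (Deln n) \<longleftrightarrow> quasi_compatible w \<sigma> \<delta>"
proof -
  obtain e where e: "shift (Deln n) e"
    using Deln_shift by blast
  obtain e' where e': "shift \<delta> e'"
    using delta_shift by blast
  have "shift (int_funpow (Sign n) i) D" for i
    unfolding Sign_def int_funpow_funpow[OF sigma_bij] by (rule sigma_shift)
  then show ?thesis
    using quasi_compatible_iff[OF Deln_commuting_skew_derivation, of n D e] e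
      quasi_compatible_iff[OF delta_commuting_skew_derivation sigma_shift e'] Deln_nilpotent_iff
    by simp
qed

end

section \<open>The ring of bounded skew power series\<close>

text \<open>
  Writing \<open>V\<close> for left multiplication by the variable, the product of \<open>a\<close> and \<open>b\<close> is the coefficientwise convergent sum of
  the series \<open>a i * (V ^^ i) b\<close>; this avoids the explicit binomial formula.
\<close>

definition series_var_mult ::
    "('a::ring_1 \<Rightarrow> 'a) \<Rightarrow> ('a \<Rightarrow> 'a) \<Rightarrow> (nat \<Rightarrow> 'a) \<Rightarrow> nat \<Rightarrow> 'a" where
  "series_var_mult \<sigma> \<delta> b k = (case k of 0 \<Rightarrow> 0 | Suc m \<Rightarrow> \<sigma> (b m)) + \<delta> (b k)"

context filtered_ring
begin

section \<open>Null sequences and convergent series\<close>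

definition null :: "(nat \<Rightarrow> 'a) \<Rightarrow> bool" where
  "null f \<longleftrightarrow> (\<forall>k. \<exists>M. \<forall>n\<ge>M. lev k (f n))"

lemma bounded_series_iff: "s \<in> bounded_series w \<longleftrightarrow> (\<exists>\<beta>. \<forall>n. lev \<beta> (s n))"
  by (simp add: bounded_series_def)

lemma filt_tendsto_unique:
  assumes "filt_tendsto w a l" "filt_tendsto w a m"
  shows "l = m"
proof -
  have "lev k (l - m)" for k
  proof -
    obtain M where "\<forall>n\<ge>M. lev k (a n - l)"
      using assms(1) unfolding filt_tendsto_def by blast
    moreover obtain M' where "\<forall>n\<ge>M'. lev k (a n - m)"
      using assms(2) unfolding filt_tendsto_def by blast
    ultimately have "lev k (a (max M M') - m)" "lev k (a (max M M') - l)"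
      by auto
    from w_diff[OF this] show ?thesis by simp
  qed
  then show ?thesis
    using lev_all_imp_zero[of "l - m"] by simp
qed

lemma filt_suminf_eq: "filt_sums w f l \<Longrightarrow> filt_suminf w f = l"
  unfolding filt_suminf_def filt_sums_def using filt_tendsto_unique by blast

lemma filt_tendsto_add:
  assumes "filt_tendsto w a l" "filt_tendsto w b m"
  shows "filt_tendsto w (\<lambda>n. a n + b n) (l + m)"
  unfolding filt_tendsto_def
proof
  fix k
  obtain M where "\<forall>n\<ge>M. lev k (a n - l)"
    using assms(1) unfolding filt_tendsto_def by blast
  moreover obtain M' where "\<forall>n\<ge>M'. lev k (b n - m)"
    using assms(2) unfolding filt_tendsto_def by blast
  ultimately have "\<forall>n\<ge>max M M'. lev k ((a n - l) + (b n - m))"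
    by (auto intro!: w_add)
  then show "\<exists>M. \<forall>n\<ge>M. lev k (a n + b n - (l + m))"
    by (intro exI[of _ "max M M'"]) (simp add: algebra_simps)
qed

lemma filt_sums_add:
  "filt_sums w f l \<Longrightarrow> filt_sums w g m \<Longrightarrow> filt_sums w (\<lambda>n. f n + g n) (l + m)"
  unfolding filt_sums_def sum.distrib by (rule filt_tendsto_add)

text \<open>Filtered additive maps are continuous, so they pass through convergent sums.\<close>

lemma filt_sums_additive:
  assumes "filt_sums w f l" and h: "additive h" "shift h d"
  shows "filt_sums w (\<lambda>n. h (f n)) (h l)"
  unfolding filt_sums_def filt_tendsto_def
proof
  fix k
  obtain M where "\<forall>n\<ge>M. lev (k - d) ((\<Sum>i<n. f i) - l)"
    using assms(1) unfolding filt_sums_def filt_tendsto_def by blast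
  then have "\<forall>n\<ge>M. lev (k - d + d) (h ((\<Sum>i<n. f i) - l))"
    using shiftD[OF h(2)] by blast
  then show "\<exists>M. \<forall>n\<ge>M. lev k ((\<Sum>i<n. h (f i)) - h l)"
    by (auto simp: additive.diff[OF h(1)] additive.sum[OF h(1)])
qed

lemma shift_mult: "\<exists>d. shift ((*) s) d" "\<exists>d. shift (\<lambda>x. x * s) d"
proof -
  obtain d where d: "lev d s"
    using lev_exists by blast
  have "shift ((*) s) d"
    unfolding shift_def
  proof (intro allI impI)
    fix k x
    assume "lev k x"
    from lev_mult[OF d this] show "lev (k + d) (s * x)"
      by (simp add: add.commute)
  qed
  moreover have "shift (\<lambda>x. x * s) d"
    unfolding shift_def by (blast intro: lev_mult d)
  ultimately show "\<exists>d. shift ((*) s) d" "\<exists>d. shift (\<lambda>x. x * s) d"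
    by blast+
qed

lemma filt_sums_mult_left: "filt_sums w f l \<Longrightarrow> filt_sums w (\<lambda>n. s * f n) (s * l)"
  using filt_sums_additive[of f l "(*) s"] shift_mult(1)[of s]
  by (auto simp: additive_def distrib_left)

lemma filt_sums_mult_right: "filt_sums w f l \<Longrightarrow> filt_sums w (\<lambda>n. f n * s) (l * s)"
  using filt_sums_additive[of f l "\<lambda>x. x * s"] shift_mult(2)[of s]
  by (auto simp: additive_def distrib_right)

lemma filt_sums_zero: "filt_sums w (\<lambda>n. 0) 0"
  by (simp add: filt_sums_def filt_tendsto_def)

lemma filt_sums_sum:
  "(\<And>j. j \<in> J \<Longrightarrow> filt_sums w (f j) (l j)) \<Longrightarrow> filt_sums w (\<lambda>n. \<Sum>j\<in>J. f j n) (\<Sum>j\<in>J. l j)"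
  by (induction J rule: infinite_finite_induct) (auto intro: filt_sums_add filt_sums_zero)

lemma sum_diff_lev:
  fixes M n :: nat
  assumes "\<And>i. M \<le> i \<Longrightarrow> lev k (f i)" "M \<le> n"
  shows "lev k ((\<Sum>i<n. f i) - (\<Sum>i<M. f i))"
proof -
  have "(\<Sum>i<n. f i) - (\<Sum>i<M. f i) = (\<Sum>i\<in>{..<n} - {..<M}. f i)"
    using assms(2) by (subst sum_diff) auto
  then show ?thesis
    using assms(1) by (auto intro!: w_sum)
qed

lemma filt_sums_tail_lev:
  assumes f: "filt_sums w f l" and "\<And>j. J \<le> j \<Longrightarrow> lev k (f j)"
  shows "lev k (l - (\<Sum>j<J. f j))"
proof -
  obtain M where "\<forall>n\<ge>M. lev k ((\<Sum>i<n. f i) - l)"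
    using f unfolding filt_sums_def filt_tendsto_def by blast
  then have "lev k ((\<Sum>i<max J M. f i) - l)" "lev k ((\<Sum>i<max J M. f i) - (\<Sum>i<J. f i))"
    using assms(2) by (auto intro: sum_diff_lev)
  from w_diff[OF this(2,1)] show ?thesis by simp
qed

lemma filt_sums_lev: "filt_sums w f l \<Longrightarrow> (\<And>j. lev k (f j)) \<Longrightarrow> lev k l"
  using filt_sums_tail_lev[of f l 0 k] by simp

text \<open>Converts between the index \<open>i + e\<close> of the product formula and an index
  running over all naturals, with zero terms below \<open>e\<close>.\<close>

lemma filt_sums_offset:
  assumes "filt_sums w (\<lambda>i. f (i + e)) l" "\<And>i. i < e \<Longrightarrow> f i = 0"
  shows "filt_sums w f l"
  unfolding filt_sums_def filt_tendsto_def
proof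
  fix k
  obtain M where "\<forall>n\<ge>M. lev k ((\<Sum>i<n. f (i + e)) - l)"
    using assms(1) unfolding filt_sums_def filt_tendsto_def by blast
  moreover have "(\<Sum>i<n + e. f i) = (\<Sum>i<n. f (i + e))" for n
    by (induction n) (simp_all add: assms(2))
  ultimately have "\<forall>n\<ge>M + e. lev k ((\<Sum>i<n. f i) - l)"
    by (metis add_le_imp_le_right le_add_diff_inverse2 le_trans le_add2)
  then show "\<exists>M. \<forall>n\<ge>M. lev k ((\<Sum>i<n. f i) - l)"
    by blast
qed

lemma filt_sums_finite:
  assumes "\<And>i. n \<le> i \<Longrightarrow> f i = 0"
  shows "filt_sums w f (\<Sum>i<n. f i)"
  unfolding filt_sums_def filt_tendsto_def using sum_diff_lev[of n _ f] assms by auto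

text \<open>Uniform smallness in \<open>j\<close> allows truncating all rows at the same column
  \<open>J\<close>; what remains is a finite sum of convergent columns.\<close>

lemma filt_sums_exchange:
  assumes rows: "\<And>i. filt_sums w (\<lambda>j. f i j) (r i)"
    and cols: "\<And>j. filt_sums w (\<lambda>i. f i j) (c j)"
    and total: "filt_sums w c y"
    and unif: "\<And>k. \<exists>J. \<forall>j\<ge>J. \<forall>i. lev k (f i j)"
  shows "filt_sums w r y"
  unfolding filt_sums_def filt_tendsto_def
proof
  fix k
  obtain J1 where J1: "\<forall>j\<ge>J1. \<forall>i. lev k (f i j)"
    using unif by blast
  obtain J2 where J2: "\<forall>n\<ge>J2. lev k ((\<Sum>j<n. c j) - y)"
    using total unfolding filt_sums_def filt_tendsto_def by blast
  define J where "J = max J1 J2"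
  have "filt_sums w (\<lambda>i. \<Sum>j<J. f i j) (\<Sum>j<J. c j)"
    by (intro filt_sums_sum cols)
  then obtain M where M: "\<forall>n\<ge>M. lev k ((\<Sum>i<n. \<Sum>j<J. f i j) - (\<Sum>j<J. c j))"
    unfolding filt_sums_def filt_tendsto_def by blast
  have "lev k ((\<Sum>i<n. r i) - y)" if n: "M \<le> n" for n
  proof -
    have "lev k (r i - (\<Sum>j<J. f i j))" for i
      using J1 by (intro filt_sums_tail_lev[OF rows]) (simp add: J_def)
    then have "lev k (\<Sum>i<n. r i - (\<Sum>j<J. f i j))"
      by (intro w_sum)
    moreover have "lev k ((\<Sum>i<n. \<Sum>j<J. f i j) - (\<Sum>j<J. c j))"
      using M n by blast
    moreover have "lev k ((\<Sum>j<J. c j) - y)"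
      using J2 by (simp add: J_def)
    \<comment> \<open>The error splits into the row tails beyond \<open>J\<close>, the convergence
      of the first \<open>J\<close> columns, and the tail of the series of column sums.\<close>
    ultimately have "lev k ((\<Sum>i<n. r i - (\<Sum>j<J. f i j)) +
        (((\<Sum>i<n. \<Sum>j<J. f i j) - (\<Sum>j<J. c j)) + ((\<Sum>j<J. c j) - y)))"
      by (intro w_add)
    then show ?thesis
      by (simp add: sum_subtractf)
  qed
  then show "\<exists>M. \<forall>n\<ge>M. lev k ((\<Sum>i<n. r i) - y)"
    by blast
qed

lemma null_add: "null f \<Longrightarrow> null g \<Longrightarrow> null (\<lambda>n. f n + g n)"
  unfolding null_def
proof
  fix k
  assume "\<forall>k. \<exists>M. \<forall>n\<ge>M. lev k (f n)" "\<forall>k. \<exists>M. \<forall>n\<ge>M. lev k (g n)"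
  then obtain M M' where "\<forall>n\<ge>M. lev k (f n)" "\<forall>n\<ge>M'. lev k (g n)"
    by meson
  then have "\<forall>n\<ge>max M M'. lev k (f n + g n)"
    by (simp add: w_add)
  then show "\<exists>M. \<forall>n\<ge>M. lev k (f n + g n)"
    by blast
qed

lemma null_sum: "(\<And>j. j \<in> J \<Longrightarrow> null (f j)) \<Longrightarrow> null (\<lambda>n. \<Sum>j\<in>J. f j n)"
  by (induction J rule: infinite_finite_induct) (auto intro: null_add simp: null_def[of "\<lambda>n. 0"])

lemma null_bounded_mult:
  assumes "a \<in> bounded_series w" "null f"
  shows "null (\<lambda>n. a (g n) * f n)"
  unfolding null_def
proof
  fix k
  obtain \<beta> where "\<And>n. lev \<beta> (a n)"
    using assms(1) unfolding bounded_series_iff by blast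
  moreover obtain M where "\<forall>n\<ge>M. lev (k - \<beta>) (f n)"
    using assms(2) unfolding null_def by blast
  moreover have "\<beta> + (k - \<beta>) = k"
    by simp
  ultimately have "\<forall>n\<ge>M. lev k (a (g n) * f n)"
    using lev_mult by metis
  then show "\<exists>M. \<forall>n\<ge>M. lev k (a (g n) * f n)"
    by blast
qed

lemma null_of_nat_mult: "null f \<Longrightarrow> null (\<lambda>n. of_nat (c n) * f n)"
  unfolding null_def by (blast intro: lev_of_nat_mult)

lemma null_offset: "null f \<Longrightarrow> null (\<lambda>n. f (n - e))"
  unfolding null_def by (metis add_le_imp_le_diff)

lemma poly_bounded_series: "poly.coeff f \<in> bounded_series w"
proof -
  have "\<forall>i. \<exists>\<beta>. lev \<beta> (poly.coeff f i)"
    using lev_exists by blast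
  from choice[OF this] obtain \<beta> where \<beta>: "\<And>i. lev (\<beta> i) (poly.coeff f i)"
    by blast
  define b where "b = Min (\<beta> ` {..Polynomial.degree f})"
  have "lev b (poly.coeff f i)" for i
  proof (cases "i \<le> Polynomial.degree f")
    case True
    then show ?thesis
      using \<beta> by (auto intro!: lev_mono[OF \<beta>] simp: b_def)
  next
    case False
    then show ?thesis
      by (simp add: coeff_eq_0)
  qed
  then show ?thesis
    unfolding bounded_series_iff by blast
qed

end

locale complete_filtered_ring = filtered_ring +
  assumes complete: "filt_complete w"
begin

text \<open>By the ultrametric inequality a difference of partial sums is no worse than its worst
  term, so null terms give Cauchy partial sums.\<close>

lemma null_sums:
  assumes "null f"
  shows "filt_sums w f (filt_suminf w f)"
proof -
  have "filt_Cauchy w (\<lambda>n. \<Sum>i<n. f i)"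
    unfolding filt_Cauchy_def
  proof
    fix k
    obtain M where "\<forall>n\<ge>M. lev k (f n)"
      using assms unfolding null_def by blast
    then have M: "lev k ((\<Sum>i<n. f i) - (\<Sum>i<M. f i))" if "M \<le> n" for n
      using that by (intro sum_diff_lev) auto
    have "\<forall>m\<ge>M. \<forall>n\<ge>M. lev k ((\<Sum>i<m. f i) - (\<Sum>i<n. f i))"
    proof (intro allI impI)
      fix m n
      assume "M \<le> m" "M \<le> n"
      from w_diff[OF M[OF this(1)] M[OF this(2)]]
      show "lev k ((\<Sum>i<m. f i) - (\<Sum>i<n. f i))" by simp
    qed
    then show "\<exists>M. \<forall>m\<ge>M. \<forall>n\<ge>M. lev k ((\<Sum>i<m. f i) - (\<Sum>i<n. f i))"
      by blast
  qed
  then obtain l where "filt_sums w f l"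
    using complete unfolding filt_complete_def filt_sums_def by blast
  then show ?thesis
    using filt_suminf_eq by metis
qed

end

locale quasi_compatible_ring = complete_filtered_ring w for w :: "'a::ring_1 \<Rightarrow> ereal" +
  fixes \<sigma> \<delta> :: "'a \<Rightarrow> 'a"
  assumes qc: "quasi_compatible w \<sigma> \<delta>"
begin

abbreviation V :: "(nat \<Rightarrow> 'a) \<Rightarrow> nat \<Rightarrow> 'a" where
  "V \<equiv> series_var_mult \<sigma> \<delta>"

section \<open>Left multiplication by the variable\<close>

lemma
  shows sigma_one: "\<sigma> 1 = 1"
    and sigma_add: "\<sigma> (r + s) = \<sigma> r + \<sigma> s"
    and sigma_mult: "\<sigma> (r * s) = \<sigma> r * \<sigma> s"
    and delta_add: "\<delta> (r + s) = \<delta> r + \<delta> s"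
    and delta_mult: "\<delta> (r * s) = \<delta> r * s + \<sigma> r * \<delta> s"
    and sigma_delta: "\<sigma> \<circ> \<delta> = \<delta> \<circ> \<sigma>"
  using qc unfolding quasi_compatible_def commuting_skew_derivation_def skew_derivation_iff by auto

lemma sigma_additive: "additive \<sigma>"
  by (simp add: additive_def sigma_add)

lemma delta_additive: "additive \<delta>"
  by (simp add: additive_def delta_add)

lemma sigma_zero [simp]: "\<sigma> 0 = 0"
  by (rule additive.zero[OF sigma_additive])

lemma delta_zero [simp]: "\<delta> 0 = 0"
  by (rule additive.zero[OF delta_additive])

lemma delta_one: "\<delta> 1 = 0"
  using delta_mult[of 1 1] by (simp add: sigma_one)

lemma sigma_shift: "\<exists>d. shift \<sigma> d"
  using qc unfolding quasi_compatible_def filtered_endo_iff by blast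

lemma delta_shift: "\<exists>d. shift \<delta> d"
  using qc unfolding quasi_compatible_def filtered_endo_iff by blast

lemma V_0: "V b 0 = \<delta> (b 0)"
  by (simp add: series_var_mult_def)

lemma V_Suc: "V b (Suc k) = \<sigma> (b k) + \<delta> (b (Suc k))"
  by (simp add: series_var_mult_def)

text \<open>\<open>V\<close> is the sum of \<delta> and of \<sigma> followed by an index shift.
  These commute because \<sigma> and \<delta> do, so the powers expand binomially.\<close>

lemma V_pow_eq:
  "(V ^^ i) b k = (\<Sum>e\<le>k. of_nat (i choose e) * (\<sigma> ^^ e) ((\<delta> ^^ (i - e)) (b (k - e))))"
proof (induction i arbitrary: k)
  case 0
  have "(\<Sum>e\<le>k. of_nat (0 choose e) * (\<sigma> ^^ e) ((\<delta> ^^ (0 - e)) (b (k - e)))) =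
      (\<Sum>e\<le>k. if e = 0 then b k else 0)"
    by (intro sum.cong) (auto simp: binomial_eq_0)
  then show ?case by simp
next
  case (Suc i)
  let ?a = "\<lambda>e. (\<sigma> ^^ e) ((\<delta> ^^ (Suc i - e)) (b (k - e)))"
  \<comment> \<open>For \<open>e > i\<close> the difference \<open>i - e\<close> is truncated to 0,
    but the binomial coefficient vanishes.\<close>
  have "\<delta> (of_nat (i choose e) * (\<sigma> ^^ e) ((\<delta> ^^ (i - e)) (b (k - e)))) = of_nat (i choose e) * ?a e" for e
  proof (cases "e \<le> i")
    case True
    then show ?thesis
      using funpow_commute[OF sigma_delta[symmetric], of e]
      by (simp add: additive_of_nat_mult[OF delta_additive] Suc_diff_le)
  qed (simp add: binomial_eq_0)
  then have \<delta>: "\<delta> ((V ^^ i) b k) = (\<Sum>e\<le>k. of_nat (i choose e) * ?a e)"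
    unfolding Suc.IH additive.sum[OF delta_additive] by simp
  show ?case
  proof (cases k)
    case 0
    then show ?thesis
      using \<delta> by (simp add: V_0)
  next
    case (Suc m)
    have "\<sigma> ((V ^^ i) b m) = (\<Sum>e\<le>m. of_nat (i choose e) * ?a (Suc e))"
      unfolding Suc.IH additive.sum[OF sigma_additive] additive_of_nat_mult[OF sigma_additive]
      by (simp add: Suc)
    moreover have "(\<Sum>e\<le>k. of_nat (Suc i choose e) * ?a e) =
        (\<Sum>e\<le>m. of_nat (i choose e) * ?a (Suc e)) + (\<Sum>e\<le>k. of_nat (i choose e) * ?a e)"
      unfolding Suc sum.atMost_Suc_shift by (simp add: sum.distrib distrib_right)
    ultimately show ?thesis
      using \<delta> by (simp add: V_Suc Suc)
  qed
qed

lemma null_sigma_delta: "null (\<lambda>i. (\<sigma> ^^ e) ((\<delta> ^^ i) s))"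
  unfolding null_def
proof
  fix k
  obtain B N where N: "0 < N" and B: "\<And>e i. shift (\<sigma> ^^ e \<circ> \<delta> ^^ i) (B + int (i div N))"
    using quasi_compatible_shift[OF qc] by blast
  obtain \<beta> where \<beta>: "lev \<beta> s"
    using lev_exists by blast
  have "\<forall>i\<ge>N * nat (k - B - \<beta>). lev k ((\<sigma> ^^ e) ((\<delta> ^^ i) s))"
  proof (intro allI impI)
    fix i
    assume "N * nat (k - B - \<beta>) \<le> i"
    then have "nat (k - B - \<beta>) \<le> i div N"
      using N div_le_mono[of "N * nat (k - B - \<beta>)" i N] by simp
    then have "k \<le> \<beta> + (B + int (i div N))"
      by linarith
    from lev_mono[OF shiftD[OF B[of e i] \<beta>] this] show "lev k ((\<sigma> ^^ e) ((\<delta> ^^ i) s))"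
      by simp
  qed
  then show "\<exists>M. \<forall>i\<ge>M. lev k ((\<sigma> ^^ e) ((\<delta> ^^ i) s))"
    by blast
qed

lemma null_V_pow: "null (\<lambda>i. (V ^^ i) b k)"
  unfolding V_pow_eq
  by (intro null_sum null_of_nat_mult null_offset null_sigma_delta)

text \<open>The loss \<open>B\<close> depends neither on \<open>i\<close> nor on \<open>b\<close>.
  This keeps products bounded and supplies the uniformity in the proof of associativity.\<close>

lemma V_pow_bounded: "\<exists>B. \<forall>b \<beta> i k. (\<forall>k. lev \<beta> (b k)) \<longrightarrow> lev (\<beta> + B) ((V ^^ i) b k)"
proof -
  obtain B N where N: "0 < N" and B: "\<And>e i. shift (\<sigma> ^^ e \<circ> \<delta> ^^ i) (B + int (i div N))"
    using quasi_compatible_shift[OF qc] by blast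
  have "lev (\<beta> + B) ((V ^^ i) b k)" if b: "\<And>k. lev \<beta> (b k)" for b \<beta> i k
    unfolding V_pow_eq
  proof (intro w_sum lev_of_nat_mult)
    fix e
    show "lev (\<beta> + B) ((\<sigma> ^^ e) ((\<delta> ^^ (i - e)) (b (k - e))))"
      using lev_mono[OF shiftD[OF B[of e "i - e"] b], of "\<beta> + B"] by simp
  qed
  then show ?thesis
    by blast
qed

lemma V_bounded_series:
  assumes "b \<in> bounded_series w"
  shows "V b \<in> bounded_series w"
proof -
  obtain B where B: "\<And>b \<beta> i k. (\<And>k. lev \<beta> (b k)) \<Longrightarrow> lev (\<beta> + B) ((V ^^ i) b k)"
    using V_pow_bounded by blast
  obtain \<beta> where \<beta>: "\<And>n. lev \<beta> (b n)"
    using assms unfolding bounded_series_iff by blast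
  have "lev (\<beta> + B) (V b n)" for n
    using B[of \<beta> b 1, OF \<beta>] by simp
  then show ?thesis
    unfolding bounded_series_iff by blast
qed

lemma V_pow_bounded_series: "b \<in> bounded_series w \<Longrightarrow> (V ^^ i) b \<in> bounded_series w"
  by (induction i) (simp_all add: V_bounded_series)

lemma V_pow_add: "(V ^^ i) (\<lambda>k. b k + c k) k = (V ^^ i) b k + (V ^^ i) c k"
proof -
  have "additive (\<sigma> ^^ e)" "additive (\<delta> ^^ e)" for e
    by (intro funpow_additive sigma_additive delta_additive)+
  then show ?thesis
    unfolding V_pow_eq by (simp add: additive.add distrib_left sum.distrib)
qed

lemma V_pow_one: "(V ^^ i) (\<lambda>n. if n = 0 then 1 else 0) = (\<lambda>n. if n = i then 1 else 0)"
proof (induction i)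
  case (Suc i)
  have "V (\<lambda>n. if n = i then 1 else 0) k = (if k = Suc i then 1 else 0)" for k
    by (cases k) (auto simp: V_0 V_Suc delta_one sigma_one)
  then show ?case
    by (auto simp: Suc)
qed auto

section \<open>The product of bounded series and its ring laws\<close>

definition smult :: "(nat \<Rightarrow> 'a) \<Rightarrow> (nat \<Rightarrow> 'a) \<Rightarrow> nat \<Rightarrow> 'a" where
  "smult a b k = filt_suminf w (\<lambda>i. a i * (V ^^ i) b k)"

lemma smult_sums:
  assumes "a \<in> bounded_series w"
  shows "filt_sums w (\<lambda>i. a i * (V ^^ i) b k) (smult a b k)"
  unfolding smult_def by (intro null_sums null_bounded_mult[OF assms] null_V_pow)

lemma smult_eqI:
  assumes "\<And>k. filt_sums w (\<lambda>i. a i * (V ^^ i) b k) (c k)"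
  shows "smult a b = c"
  unfolding smult_def using filt_suminf_eq[OF assms] by auto

lemma skew_series_term_sums:
  assumes a: "a \<in> bounded_series w"
  shows "filt_sums w (skew_series_term \<sigma> \<delta> a b k e) (filt_suminf w (skew_series_term \<sigma> \<delta> a b k e))"
proof (rule null_sums)
  have "skew_series_term \<sigma> \<delta> a b k e =
      (\<lambda>i. of_nat ((i + e) choose e) * (a (i + e) * (\<sigma> ^^ e) ((\<delta> ^^ i) (b (k - e)))))"
    by (simp add: skew_series_term_def fun_eq_iff mult.assoc)
  then show "null (skew_series_term \<sigma> \<delta> a b k e)"
    using null_of_nat_mult[OF null_bounded_mult[OF a null_sigma_delta]] by simp
qed

text \<open>The finite sum over \<open>e\<close> may be taken inside the convergent sums over
  \<open>i\<close>, where it becomes the binomial formula for \<open>V ^^ i\<close>.\<close>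

lemma skew_series_mult_eq:
  assumes a: "a \<in> bounded_series w"
  shows "skew_series_mult w \<sigma> \<delta> a b = smult a b"
proof (rule smult_eqI[symmetric])
  fix k
  let ?f = "\<lambda>e i. of_nat (i choose e) * a i * (\<sigma> ^^ e) ((\<delta> ^^ (i - e)) (b (k - e)))"
  have "filt_sums w (?f e) (filt_suminf w (skew_series_term \<sigma> \<delta> a b k e))" for e
    by (rule filt_sums_offset[where e = e])
      (use skew_series_term_sums[OF a, of b k e] in \<open>simp_all add: skew_series_term_def[abs_def] binomial_eq_0\<close>)
  then have "filt_sums w (\<lambda>i. \<Sum>e\<le>k. ?f e i) (skew_series_mult w \<sigma> \<delta> a b k)"
    unfolding skew_series_mult_def by (intro filt_sums_sum)
  moreover have "(\<Sum>e\<le>k. ?f e i) = a i * (V ^^ i) b k" for i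
    unfolding V_pow_eq sum_distrib_left
    by (intro sum.cong refl) (metis mult.assoc mult_of_nat_commute)
  ultimately show "filt_sums w (\<lambda>i. a i * (V ^^ i) b k) (skew_series_mult w \<sigma> \<delta> a b k)"
    by simp
qed

lemma smult_bounded:
  assumes a: "a \<in> bounded_series w" and b: "b \<in> bounded_series w"
  shows "smult a b \<in> bounded_series w"
proof -
  obtain \<alpha> \<beta> where \<alpha>: "\<And>i. lev \<alpha> (a i)" and \<beta>: "\<And>i. lev \<beta> (b i)"
    using a b unfolding bounded_series_iff by blast
  obtain B where B: "\<And>b \<beta> i k. (\<And>k. lev \<beta> (b k)) \<Longrightarrow> lev (\<beta> + B) ((V ^^ i) b k)"
    using V_pow_bounded by blast
  have "lev (\<alpha> + (\<beta> + B)) (a i * (V ^^ i) b k)" for i k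
    by (rule lev_mult[OF \<alpha> B[OF \<beta>]])
  then have "lev (\<alpha> + (\<beta> + B)) (smult a b k)" for k
    by (intro filt_sums_lev[OF smult_sums[OF a]])
  then show ?thesis
    unfolding bounded_series_iff by blast
qed

lemma bounded_series_add:
  assumes "a \<in> bounded_series w" "b \<in> bounded_series w"
  shows "(\<lambda>n. a n + b n) \<in> bounded_series w"
proof -
  obtain \<alpha> \<beta> where \<alpha>: "\<And>i. lev \<alpha> (a i)" and \<beta>: "\<And>i. lev \<beta> (b i)"
    using assms unfolding bounded_series_iff by blast
  have "lev (min \<alpha> \<beta>) (a n + b n)" for n
    by (intro w_add lev_mono[OF \<alpha>] lev_mono[OF \<beta>]) auto
  then show ?thesis
    unfolding bounded_series_iff by blast
qed

lemma smult_add_left: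
  assumes "a \<in> bounded_series w" "b \<in> bounded_series w"
  shows "smult (\<lambda>n. a n + b n) c = (\<lambda>n. smult a c n + smult b c n)"
  using filt_sums_add[OF smult_sums[OF assms(1)] smult_sums[OF assms(2)]]
  by (intro smult_eqI) (simp add: distrib_right)

lemma smult_add_right:
  assumes "a \<in> bounded_series w"
  shows "smult a (\<lambda>n. b n + c n) = (\<lambda>n. smult a b n + smult a c n)"
  using filt_sums_add[OF smult_sums[OF assms] smult_sums[OF assms]]
  by (intro smult_eqI) (simp add: distrib_left V_pow_add)

lemma smult_one_right: "smult a (\<lambda>n. if n = 0 then 1 else 0) = a"
proof (rule smult_eqI)
  fix k
  have "(\<lambda>i. a i * (V ^^ i) (\<lambda>n. if n = 0 then 1 else 0) k) = (\<lambda>i. if i = k then a k else 0)"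
    by (auto simp: V_pow_one)
  then show "filt_sums w (\<lambda>i. a i * (V ^^ i) (\<lambda>n. if n = 0 then 1 else 0) k) (a k)"
    using filt_sums_finite[of "Suc k" "\<lambda>i. if i = k then a k else 0"] by simp
qed

lemma smult_const_left: "smult (\<lambda>n. if n = 0 then s else 0) a = (\<lambda>k. s * a k)"
proof (rule smult_eqI)
  fix k
  show "filt_sums w (\<lambda>i. (if i = 0 then s else 0) * (V ^^ i) a k) (s * a k)"
    using filt_sums_finite[of 1 "\<lambda>i. (if i = 0 then s else 0) * (V ^^ i) a k"] by simp
qed

text \<open>Apply \<sigma> and \<delta> termwise to the series for the product. The skew Leibniz
  rule produces an extra sum of terms \<open>\<sigma> (b i) * \<delta> ((V ^^ i) c k)\<close>, and
  the same sum arises from \<open>(V ^^ Suc i) c\<close>, so it cancels.\<close>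

lemma V_smult:
  assumes b: "b \<in> bounded_series w"
  shows "V (smult b c) = smult (V b) c"
proof (rule smult_eqI[symmetric])
  fix k
  have \<delta>: "filt_sums w (\<lambda>i. \<delta> (b i * (V ^^ i) c k)) (\<delta> (smult b c k))"
    using filt_sums_additive[OF smult_sums[OF b] delta_additive] delta_shift by blast
  \<comment> \<open>The difference of the first two terms of the limit is the \<sigma>-part of
    \<open>V (smult b c) k\<close>, which is 0 for \<open>k = 0\<close>; \<open>s\<close> is the
    extra sum, subtracted again at the end.\<close>
  have "filt_sums w (\<lambda>i. (case i of 0 \<Rightarrow> 0 | Suc j \<Rightarrow> \<sigma> (b j) * (V ^^ i) c k))
      (V (smult b c) k - \<delta> (smult b c k) + s)"
    if "filt_sums w (\<lambda>i. \<sigma> (b i) * \<delta> ((V ^^ i) c k)) s" for s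
  proof (rule filt_sums_offset[where e = 1])
    have "filt_sums w (\<lambda>i. \<sigma> (b i) * (V ^^ Suc i) c k) (V (smult b c) k - \<delta> (smult b c k) + s)"
    proof (cases k)
      case 0
      then show ?thesis
        using that by (simp add: V_0)
    next
      case (Suc m)
      have "filt_sums w (\<lambda>i. \<sigma> (b i * (V ^^ i) c m)) (\<sigma> (smult b c m))"
        using filt_sums_additive[OF smult_sums[OF b] sigma_additive] sigma_shift by blast
      from filt_sums_add[OF this that] show ?thesis
        by (simp add: Suc V_Suc sigma_mult distrib_left)
    qed
    then show "filt_sums w (\<lambda>i. case i + 1 of 0 \<Rightarrow> 0 | Suc j \<Rightarrow> \<sigma> (b j) * (V ^^ (i + 1)) c k)
        (V (smult b c) k - \<delta> (smult b c k) + s)"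
      by simp
  qed simp
  moreover have "\<sigma> \<circ> b \<in> bounded_series w"
  proof -
    obtain d where d: "shift \<sigma> d"
      using sigma_shift by blast
    obtain \<beta> where "\<And>i. lev \<beta> (b i)"
      using b unfolding bounded_series_iff by blast
    then have "lev (\<beta> + d) ((\<sigma> \<circ> b) i)" for i
      using shiftD[OF d] by simp
    then show ?thesis
      unfolding bounded_series_iff by blast
  qed
  then obtain s where s: "filt_sums w (\<lambda>i. \<sigma> (b i) * \<delta> ((V ^^ i) c k)) s"
  proof -
    have "null (\<lambda>i. \<delta> ((V ^^ i) c k))"
      unfolding null_def
    proof
      fix m
      obtain d where d: "shift \<delta> d"
        using delta_shift by blast
      obtain M where "\<forall>i\<ge>M. lev (m - d) ((V ^^ i) c k)"
        using null_V_pow unfolding null_def by blast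
      then have "\<forall>i\<ge>M. lev (m - d + d) (\<delta> ((V ^^ i) c k))"
        using shiftD[OF d] by blast
      then show "\<exists>M. \<forall>i\<ge>M. lev m (\<delta> ((V ^^ i) c k))"
        by auto
    qed
    from null_sums[OF null_bounded_mult[OF \<open>\<sigma> \<circ> b \<in> bounded_series w\<close> this, of id]] that
    show ?thesis by auto
  qed
  ultimately have "filt_sums w (\<lambda>i. (case i of 0 \<Rightarrow> 0 | Suc j \<Rightarrow> \<sigma> (b j) * (V ^^ i) c k))
      (V (smult b c) k - \<delta> (smult b c k) + s)"
    by blast
  from filt_sums_add[OF filt_sums_add[OF this \<delta>] filt_sums_mult_left[OF s, of "- 1"]]
  have "filt_sums w (\<lambda>i. (case i of 0 \<Rightarrow> 0 | Suc j \<Rightarrow> \<sigma> (b j) * (V ^^ i) c k) +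
      \<delta> (b i * (V ^^ i) c k) - \<sigma> (b i) * \<delta> ((V ^^ i) c k)) (V (smult b c) k)"
    by simp
  moreover have "(case i of 0 \<Rightarrow> 0 | Suc j \<Rightarrow> \<sigma> (b j) * (V ^^ i) c k) +
      \<delta> (b i * (V ^^ i) c k) - \<sigma> (b i) * \<delta> ((V ^^ i) c k) = V b i * (V ^^ i) c k" for i
    by (cases i) (simp_all add: V_0 V_Suc delta_mult distrib_right)
  ultimately show "filt_sums w (\<lambda>i. V b i * (V ^^ i) c k) (V (smult b c) k)"
    by simp
qed

lemma V_pow_smult: "b \<in> bounded_series w \<Longrightarrow> (V ^^ i) (smult b c) = smult ((V ^^ i) b) c"
  by (induction i) (simp_all add: V_smult V_pow_bounded_series)

lemma smult_assoc:
  assumes a: "a \<in> bounded_series w" and b: "b \<in> bounded_series w"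
  shows "smult a (smult b c) = smult (smult a b) c"
proof (rule smult_eqI)
  fix k
  have ab: "smult a b \<in> bounded_series w"
    by (rule smult_bounded[OF a b])
  show "filt_sums w (\<lambda>i. a i * (V ^^ i) (smult b c) k) (smult (smult a b) c k)"
  proof (rule filt_sums_exchange[where f = "\<lambda>i j. a i * (V ^^ i) b j * (V ^^ j) c k"])
    show "filt_sums w (\<lambda>j. a i * (V ^^ i) b j * (V ^^ j) c k) (a i * (V ^^ i) (smult b c) k)" for i
      using filt_sums_mult_left[OF smult_sums[OF V_pow_bounded_series[OF b]]]
      by (simp add: V_pow_smult[OF b] mult.assoc)
    show "filt_sums w (\<lambda>i. a i * (V ^^ i) b j * (V ^^ j) c k) (smult a b j * (V ^^ j) c k)" for j
      by (intro filt_sums_mult_right smult_sums a)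
    show "filt_sums w (\<lambda>j. smult a b j * (V ^^ j) c k) (smult (smult a b) c k)"
      by (rule smult_sums[OF ab])
    fix m
    obtain \<alpha> \<beta> where \<alpha>: "\<And>i. lev \<alpha> (a i)" and \<beta>: "\<And>i. lev \<beta> (b i)"
      using a b unfolding bounded_series_iff by blast
    obtain B where B: "\<And>b \<beta> i k. (\<And>k. lev \<beta> (b k)) \<Longrightarrow> lev (\<beta> + B) ((V ^^ i) b k)"
      using V_pow_bounded by blast
    \<comment> \<open>A level for all products \<open>a i * (V ^^ i) b j\<close>, whatever
      \<open>i\<close> and \<open>j\<close>; hence the cutoff \<open>J\<close> can be chosen from
      \<open>c\<close> alone.\<close>
    define g where "g = \<alpha> + (\<beta> + B)"
    obtain J where J: "\<forall>j\<ge>J. lev (m - g) ((V ^^ j) c k)"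
      using null_V_pow[of c k] unfolding null_def by blast
    have "lev m (a i * (V ^^ i) b j * (V ^^ j) c k)" if "J \<le> j" for i j
    proof -
      have 1: "lev g (a i * (V ^^ i) b j)"
        unfolding g_def by (rule lev_mult[OF \<alpha> B[OF \<beta>]])
      have 2: "lev (m - g) ((V ^^ j) c k)"
        using J that by blast
      from lev_mult[OF 1 2] show ?thesis by simp
    qed
    then show "\<exists>J. \<forall>j\<ge>J. \<forall>i. lev m (a i * (V ^^ i) b j * (V ^^ j) c k)"
      by blast
  qed
qed

lemma one_bounded_series: "(\<lambda>n. if n = 0 then 1 else 0) \<in> bounded_series w"
  unfolding bounded_series_iff by (intro exI[of _ 0]) simp

theorem ring_skew_series_ring: "ring (skew_series_ring w \<sigma> \<delta>)"
proof (rule ringI)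
  show "abelian_group (skew_series_ring w \<sigma> \<delta>)"
  proof (rule abelian_groupI)
    fix a
    assume "a \<in> carrier (skew_series_ring w \<sigma> \<delta>)"
    then have "(\<lambda>n. - a n) \<in> bounded_series w"
      by (auto simp: skew_series_ring_def bounded_series_iff intro: w_minus)
    then show "\<exists>b\<in>carrier (skew_series_ring w \<sigma> \<delta>). b \<oplus>\<^bsub>skew_series_ring w \<sigma> \<delta>\<^esub> a = \<zero>\<^bsub>skew_series_ring w \<sigma> \<delta>\<^esub>"
      by (intro bexI[of _ "\<lambda>n. - a n"]) (auto simp: skew_series_ring_def)
  qed (auto simp: skew_series_ring_def add_ac bounded_series_add bounded_series_iff[of "\<lambda>n. 0"])
  show "monoid (skew_series_ring w \<sigma> \<delta>)"
    by unfold_locales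
      (auto simp: skew_series_ring_def skew_series_mult_eq smult_bounded smult_assoc one_bounded_series
        smult_const_left smult_one_right)
qed (simp_all add: skew_series_ring_def skew_series_mult_eq bounded_series_add smult_add_left smult_add_right)

theorem skew_series_ring_exists: "skew_series_ring_exists w \<sigma> \<delta>"
  unfolding skew_series_ring_exists_def
  using filtration complete qc ring_skew_series_ring skew_series_term_sums by blast

section \<open>Skew polynomials inside the skew power series\<close>

lemma coeff_skew_var_mult: "poly.coeff (skew_var_mult \<sigma> \<delta> g) = V (poly.coeff g)"
  by (auto simp: fun_eq_iff skew_var_mult_def series_var_mult_def coeff_map_poly coeff_pCons split: nat.split)

lemma coeff_skew_var_mult_pow: "poly.coeff ((skew_var_mult \<sigma> \<delta> ^^ i) g) = (V ^^ i) (poly.coeff g)"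
  by (induction i) (simp_all add: coeff_skew_var_mult)

lemma coeff_skew_poly_mult:
  "poly.coeff (skew_poly_mult \<sigma> \<delta> f g) = smult (poly.coeff f) (poly.coeff g)"
proof (rule smult_eqI[symmetric])
  fix k
  have "filt_sums w (\<lambda>i. poly.coeff f i * (V ^^ i) (poly.coeff g) k)
      (\<Sum>i<Suc (Polynomial.degree f). poly.coeff f i * (V ^^ i) (poly.coeff g) k)"
    by (rule filt_sums_finite) (simp add: coeff_eq_0)
  then show "filt_sums w (\<lambda>i. poly.coeff f i * (V ^^ i) (poly.coeff g) k)
      (poly.coeff (skew_poly_mult \<sigma> \<delta> f g) k)"
    by (simp add: skew_poly_mult_def coeff_sum coeff_map_poly coeff_skew_var_mult_pow lessThan_Suc_atMost)
qed

lemma coeff_const: "poly.coeff [:s:] = (\<lambda>n. if n = 0 then s else 0)"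
  by (auto simp: coeff_pCons split: nat.split)

text \<open>The coefficient map is injective and turns the polynomial product into the series
  product, so the laws of multiplication are inherited.\<close>

lemma ring_skew_poly_ring: "ring (skew_poly_ring \<sigma> \<delta>)"
proof (rule ringI)
  note bounded = poly_bounded_series
  have add: "poly.coeff (f + g) = (\<lambda>n. poly.coeff f n + poly.coeff g n)" for f g :: "'a poly"
    by auto
  note simps = skew_poly_ring_def poly_eq_iff coeff_skew_poly_mult fun_cong[OF smult_assoc]
  show "abelian_group (skew_poly_ring \<sigma> \<delta>)"
    by (rule abelian_groupI) (auto simp: skew_poly_ring_def add_ac intro: exI[of _ "- f" for f])
  show "monoid (skew_poly_ring \<sigma> \<delta>)"
    by unfold_locales
      (auto simp: skew_poly_ring_def poly_eq_iff coeff_skew_poly_mult smult_assoc bounded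
        coeff_const smult_const_left smult_one_right)
qed (auto simp: skew_poly_ring_def poly_eq_iff coeff_skew_poly_mult smult_add_left[OF poly_bounded_series poly_bounded_series]
    smult_add_right[OF poly_bounded_series] coeff_add[abs_def])

end

context quasi_compatible_ring
begin

section \<open>Scalars, finite sums and coefficients commuting with the variable\<close>

lemma smult_scale_left:
  assumes "a \<in> bounded_series w"
  shows "smult (\<lambda>n. s * a n) b = (\<lambda>k. s * smult a b k)"
  using filt_sums_mult_left[OF smult_sums[OF assms]]
  by (intro smult_eqI) (simp add: mult.assoc)

lemma bounded_series_scale:
  assumes "a \<in> bounded_series w"
  shows "(\<lambda>n. s * a n) \<in> bounded_series w"
proof -
  obtain \<beta> \<gamma> where "\<And>n. lev \<beta> (a n)" and "lev \<gamma> s"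
    using assms lev_exists[of s] unfolding bounded_series_iff by blast
  then have "lev (\<gamma> + \<beta>) (s * a n)" for n
    by (intro lev_mult)
  then show ?thesis
    unfolding bounded_series_iff by blast
qed

lemma zero_bounded_series: "(\<lambda>n. 0) \<in> bounded_series w"
  by (simp add: bounded_series_iff)

lemma bounded_series_sum:
  "(\<And>i. i \<in> I \<Longrightarrow> a i \<in> bounded_series w) \<Longrightarrow> (\<lambda>n. \<Sum>i\<in>I. a i n) \<in> bounded_series w"
  by (induction I rule: infinite_finite_induct) (auto intro: bounded_series_add zero_bounded_series)

lemma const_bounded_series: "(\<lambda>n. if n = 0 then s else 0) \<in> bounded_series w"
  using poly_bounded_series[of "[:s:]"] by (simp add: coeff_const)

lemma smult_zero_left: "smult (\<lambda>n. 0) b = (\<lambda>k. 0)"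
  by (rule smult_eqI) (simp add: filt_sums_zero)

lemma smult_zero_right: "smult a (\<lambda>n. 0) = (\<lambda>k. 0)"
proof (rule smult_eqI)
  have "(V ^^ i) (\<lambda>n. 0) = (\<lambda>n. 0)" for i
    by (induction i) (auto simp: series_var_mult_def split: nat.split)
  then show "filt_sums w (\<lambda>i. a i * (V ^^ i) (\<lambda>n. 0) k) 0" for k
    by (simp add: filt_sums_zero)
qed

lemma smult_sum_left:
  assumes "finite I" "\<And>i. i \<in> I \<Longrightarrow> a i \<in> bounded_series w"
  shows "smult (\<lambda>n. \<Sum>i\<in>I. a i n) b = (\<lambda>k. \<Sum>i\<in>I. smult (a i) b k)"
  using assms by (induction I) (simp_all add: smult_zero_left smult_add_left bounded_series_sum)

lemma smult_sum_right:
  assumes "a \<in> bounded_series w" "finite I"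
  shows "smult a (\<lambda>n. \<Sum>i\<in>I. b i n) = (\<lambda>k. \<Sum>i\<in>I. smult a (b i) k)"
  using assms(2) by (induction I) (simp_all add: smult_zero_right smult_add_right assms(1))

text \<open>Coefficients fixed by \<sigma> and killed by \<delta> commute with the variable:
  \<open>V\<close> merely shifts \<open>b\<close>, and the product is the ordinary Cauchy
  product.\<close>

lemma smult_central:
  assumes "\<And>j. \<sigma> (b j) = b j" "\<And>j. \<delta> (b j) = 0"
  shows "smult a b k = (\<Sum>i\<le>k. a i * b (k - i))"
proof -
  have V: "(V ^^ i) b k = (if k < i then 0 else b (k - i))" for i k
  proof (induction i arbitrary: k)
    case (Suc i)
    then show ?case
      using assms by (cases k) (auto simp: V_0 V_Suc Suc_diff_le)
  qed simp
  have "filt_sums w (\<lambda>i. a i * (V ^^ i) b k) (\<Sum>i<Suc k. a i * (V ^^ i) b k)"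
    by (rule filt_sums_finite) (simp add: V)
  then show ?thesis
    unfolding smult_def by (simp add: filt_suminf_eq V lessThan_Suc_atMost)
qed

lemma smult_const_right:
  assumes "\<And>i. 2 \<le> i \<Longrightarrow> a i = 0"
  shows "smult a (\<lambda>n. if n = 0 then s else 0) =
    (\<lambda>k. if k = 0 then a 0 * s + a 1 * \<delta> s else if k = 1 then a 1 * \<sigma> s else 0)"
proof (rule smult_eqI)
  fix k
  let ?f = "\<lambda>i. a i * (V ^^ i) (\<lambda>n. if n = 0 then s else 0) k"
  have "filt_sums w ?f (\<Sum>i<2. ?f i)"
    by (rule filt_sums_finite) (simp add: assms)
  also have "(\<Sum>i<2. ?f i) =
      (if k = 0 then a 0 * s + a 1 * \<delta> s else if k = 1 then a 1 * \<sigma> s else 0)"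
    by (cases k) (auto simp: numeral_2_eq_2 V_0 V_Suc)
  finally show "filt_sums w ?f \<dots>" .
qed

end

section \<open>The natural map\<close>

locale inner_quasi_compatible = inner_skew_derivation w \<sigma> \<delta> t p D + Q: quasi_compatible_ring w \<sigma> \<delta>
  for w :: "'a::ring_1 \<Rightarrow> ereal" and \<sigma> \<delta> t p D
begin

definition Xn :: "nat \<Rightarrow> 'a poly" where
  "Xn n = ([:0, 1:] - [:t:]) [^]\<^bsub>skew_poly_ring \<sigma> \<delta>\<^esub> (p ^ n) + [:Tn n:]"

text \<open>Weaker than lying in the centre of the ring: such elements form a subring that \<delta>
  kills, so they commute with the variable.\<close>

definition central :: "'a \<Rightarrow> bool" where
  "central s \<longleftrightarrow> \<sigma> s = s \<and> t * s = s * t"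

lemma central_delta: "central s \<Longrightarrow> \<delta> s = 0"
  by (simp add: central_def delta)

lemma central_zero: "central 0"
  by (simp add: central_def)

lemma central_one: "central 1"
  by (simp add: central_def sigma_one)

lemma central_add: "central r \<Longrightarrow> central s \<Longrightarrow> central (r + s)"
  by (simp add: central_def sigma_add algebra_simps)

lemma central_mult: "central r \<Longrightarrow> central s \<Longrightarrow> central (r * s)"
  by (simp add: central_def sigma_mult) (metis mult.assoc)

lemma central_sum: "(\<And>i. i \<in> I \<Longrightarrow> central (f i)) \<Longrightarrow> central (sum f I)"
  by (induction I rule: infinite_finite_induct) (auto intro: central_add central_zero)

lemma central_of_int: "central (of_int n)"
  using additive_of_int_mult[OF sigma_pow_additive[of 1], of n 1]
  by (simp add: central_def sigma_one mult_of_int_commute)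

lemma central_power: "central s \<Longrightarrow> central (s ^ m)"
  by (induction m) (auto intro: central_one central_mult)

lemma central_minus_t: "central (- t)"
  using central_mult[OF central_of_int[of "- 1"], of t] by (simp add: central_def sigma_t)

lemma central_Tn: "central (Tn n)"
  unfolding Tn_eq by (intro central_mult central_of_int central_power) (simp add: central_def sigma_t)

text \<open>The coefficients of \<open>x - t\<close> commute with the variable and with each other,
  so the classical binomial theorem applies.\<close>

lemma coeff_linear_power:
  "poly.coeff (([:0, 1:] - [:t:]) [^]\<^bsub>skew_poly_ring \<sigma> \<delta>\<^esub> m) k = of_nat (m choose k) * (- t) ^ (m - k)"
proof (induction m arbitrary: k)
  case 0
  then show ?case
    by (cases k) (auto simp: nat_pow_def skew_poly_ring_def)
next
  case (Suc m)
  let ?y = "[:0, 1:] - [:t:]"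
  let ?c = "poly.coeff (?y [^]\<^bsub>skew_poly_ring \<sigma> \<delta>\<^esub> m)"
  have y: "poly.coeff ?y j = (if j = 0 then - t else if j = 1 then 1 else 0)" for j
    by (auto simp: coeff_pCons split: nat.split)
  have "central (poly.coeff ?y j)" for j
    unfolding y by (simp add: central_minus_t central_one central_zero)
  then have "poly.coeff (?y [^]\<^bsub>skew_poly_ring \<sigma> \<delta>\<^esub> Suc m) k = (\<Sum>i\<le>k. ?c i * poly.coeff ?y (k - i))"
    using Q.smult_central[of "poly.coeff ?y"] central_delta
    by (simp add: nat_pow_def skew_poly_ring_def Q.coeff_skew_poly_mult central_def)
  also have "\<dots> = ?c k * (- t) + (case k of 0 \<Rightarrow> 0 | Suc j \<Rightarrow> ?c j)"
  proof (cases k)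
    case (Suc j)
    have "(\<Sum>i\<le>k. ?c i * poly.coeff ?y (k - i)) =
        (\<Sum>i<j. ?c i * poly.coeff ?y (k - i)) + ?c j + ?c k * (- t)"
      by (simp add: Suc y lessThan_Suc_atMost[symmetric])
    also have "(\<Sum>i<j. ?c i * poly.coeff ?y (k - i)) = 0"
      unfolding y by (rule sum.neutral) (auto simp: Suc)
    finally show ?thesis
      by (simp add: Suc)
  qed (simp add: y)
  also have "\<dots> = of_nat (Suc m choose k) * (- t) ^ (Suc m - k)"
  proof (cases k)
    case 0
    then show ?thesis
      unfolding Suc.IH by (simp add: power_Suc2 del: power_Suc)
  next
    case (Suc j)
    show ?thesis
    proof (cases "k \<le> m")
      case True
      then have "m - j = Suc (m - k)"
        using Suc by simp
      then show ?thesis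
        using Suc True unfolding Suc.IH
        by (simp add: power_Suc2 distrib_right mult.assoc del: power_Suc)
    next
      case False
      then show ?thesis
        using Suc unfolding Suc.IH by (simp add: binomial_eq_0)
    qed
  qed
  finally show ?case .
qed

text \<open>Iterates \<open>(x - t) s = \<sigma>(s) (x - t)\<close>: replacing \<open>x\<close> by
  \<open>x - t\<close> removes an inner derivation.\<close>

lemma smult_linear_power_const:
  "Q.smult (poly.coeff (([:0, 1:] - [:t:]) [^]\<^bsub>skew_poly_ring \<sigma> \<delta>\<^esub> m)) (\<lambda>k. if k = 0 then s else 0) =
     (\<lambda>k. (\<sigma> ^^ m) s * poly.coeff (([:0, 1:] - [:t:]) [^]\<^bsub>skew_poly_ring \<sigma> \<delta>\<^esub> m) k)"
proof (induction m arbitrary: s)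
  case 0
  then show ?case
    using Q.smult_const_left[of 1] by (auto simp: nat_pow_def skew_poly_ring_def Q.coeff_const)
next
  case (Suc m)
  let ?y = "[:0, 1:] - [:t:]"
  let ?Y = "?y [^]\<^bsub>skew_poly_ring \<sigma> \<delta>\<^esub> m"
  have y: "poly.coeff ?y j = (if j = 0 then - t else if j = 1 then 1 else 0)" for j
    by (auto simp: coeff_pCons split: nat.split)
  have step: "poly.coeff (?y [^]\<^bsub>skew_poly_ring \<sigma> \<delta>\<^esub> Suc m) = Q.smult (poly.coeff ?Y) (poly.coeff ?y)"
    by (simp add: nat_pow_def skew_poly_ring_def Q.coeff_skew_poly_mult)
  have "Q.smult (poly.coeff ?y) (\<lambda>k. if k = 0 then s else 0) =
      (\<lambda>k. if k = 0 then poly.coeff ?y 0 * s + poly.coeff ?y 1 * \<delta> s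
        else if k = 1 then poly.coeff ?y 1 * \<sigma> s else 0)"
    by (rule Q.smult_const_right) (unfold y, simp)
  \<comment> \<open>In the constant term \<open>- t * s + \<delta> s = - \<sigma> s * t\<close>,
    because \<delta> is inner.\<close>
  also have "\<dots> = (\<lambda>k. \<sigma> s * poly.coeff ?y k)"
    unfolding y by (auto simp: delta)
  also have "\<dots> = Q.smult (\<lambda>k. if k = 0 then \<sigma> s else 0) (poly.coeff ?y)"
    by (simp add: Q.smult_const_left)
  finally have "Q.smult (poly.coeff (?y [^]\<^bsub>skew_poly_ring \<sigma> \<delta>\<^esub> Suc m)) (\<lambda>k. if k = 0 then s else 0) =
      Q.smult (Q.smult (poly.coeff ?Y) (\<lambda>k. if k = 0 then \<sigma> s else 0)) (poly.coeff ?y)"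
    unfolding step Q.smult_assoc[OF poly_bounded_series poly_bounded_series, symmetric]
      Q.smult_assoc[OF poly_bounded_series Q.const_bounded_series, symmetric] by simp
  also have "\<dots> = (\<lambda>k. (\<sigma> ^^ Suc m) s * Q.smult (poly.coeff ?Y) (poly.coeff ?y) k)"
    unfolding Suc.IH Q.smult_scale_left[OF poly_bounded_series] by (simp add: funpow_swap1)
  finally show ?case
    unfolding step .
qed

lemma coeff_Xn:
  "poly.coeff (Xn n) = (\<lambda>k. poly.coeff (([:0, 1:] - [:t:]) [^]\<^bsub>skew_poly_ring \<sigma> \<delta>\<^esub> (p ^ n)) k +
     (if k = 0 then Tn n else 0))"
  by (auto simp: Xn_def coeff_pCons split: nat.split)

text \<open>The relation defining the skew polynomial ring in \<open>Y\<close>, with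
  \<open>Xn n\<close> in place of \<open>Y\<close>; this is what makes the substitution
  multiplicative.\<close>

lemma smult_Xn_const:
  "Q.smult (poly.coeff (Xn n)) (\<lambda>k. if k = 0 then s else 0) =
     (\<lambda>k. Sign n s * poly.coeff (Xn n) k + (if k = 0 then Deln n s else 0))"
  unfolding coeff_Xn Q.smult_add_left[OF poly_bounded_series Q.const_bounded_series]
    smult_linear_power_const Q.smult_const_left
  by (auto simp: Sign_def Deln_def algebra_simps)

lemma central_Xn: "central (poly.coeff (Xn n) k)"
proof -
  have "of_nat m = (of_int (int m) :: 'a)" for m
    by simp
  then show ?thesis
    unfolding coeff_Xn coeff_linear_power
    by (auto simp only: central_zero central_Tn split: if_split
        intro!: central_add central_mult central_of_int central_power central_minus_t)
qed

text \<open>The bound is 1 for the constant coefficient and 0 for all others. The constant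
  coefficient is a multiple of \<open>p\<close> thanks to the sign of \<open>Tn\<close>, the inner
  ones through their binomial coefficients, and the leading one is 1.\<close>

lemma lev_Xn: "lev (max 0 (1 - int k)) (poly.coeff (Xn n) k)"
proof -
  let ?q = "p ^ n"
  have p: "lev 1 (of_nat p * r * t ^ m)" if "lev 0 r" for r m
  proof (cases "of_nat p = (0::'a)")
    case False
    have "lev (1 + 0 + 0) (of_nat p * r * t ^ m)"
      by (intro lev_mult lev_p that lev_power_0 lev_t[OF False])
    then show ?thesis by simp
  qed simp
  have minus_t: "(- t) ^ m = of_int ((- 1) ^ m) * t ^ m" for m
    by (cases "even m") auto
  consider "k = 0" | "0 < k" "k < ?q" | "k = ?q" "0 < k" | "?q < k"
    by linarith
  then show ?thesis
  proof cases
    case 1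
    obtain d where d: "(- 1) ^ (p + 1) + (- 1) ^ ?q = int p * d"
      using minus_one_power_prime_power(2)[OF prime_p] by blast
    have "poly.coeff (Xn n) k = of_int ((- 1) ^ (p + 1) + (- 1) ^ ?q) * t ^ ?q"
      unfolding coeff_Xn coeff_linear_power minus_t Tn_eq 1 of_int_add distrib_right by (simp add: add.commute)
    also have "\<dots> = of_nat p * of_int d * t ^ ?q"
      unfolding d by simp
    finally show ?thesis
      using p[OF lev_of_int[of d]] 1 by (simp add: one_ereal_def)
  next
    case 2
    then obtain c where c: "?q choose k = p * c"
      using dvd_choose_prime_power[OF prime_p] by blast
    have "poly.coeff (Xn n) k = of_nat p * of_int (int c * (- 1) ^ (?q - k)) * t ^ (?q - k)"
      using 2 unfolding coeff_Xn coeff_linear_power minus_t c by (simp add: mult.assoc)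
    then show ?thesis
      using lev_mono[OF p[OF lev_of_int[of "int c * (- 1) ^ (?q - k)"]], of 0 "?q - k"] 2
      by simp
  next
    case 3
    then have "poly.coeff (Xn n) k = 1"
      unfolding coeff_Xn coeff_linear_power 3(1)[symmetric] by simp
    then show ?thesis
      using 3(2) by simp
  next
    case 4
    then show ?thesis
      unfolding coeff_Xn coeff_linear_power by (simp add: binomial_eq_0)
  qed
qed

text \<open>
  The level \<open>max 0 (i - k)\<close> is what makes the degree of the natural map non-negative for \<open>\<epsilon> \<le> 1\<close>,
  as then \<open>max 0 (i - k) + \<epsilon> k \<ge> \<epsilon> i\<close>.
\<close>

lemma Xn_power:
  defines "R \<equiv> skew_series_ring w \<sigma> \<delta>"
  shows "poly.coeff (Xn n) [^]\<^bsub>R\<^esub> i \<in> bounded_series w \<and>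
    (\<forall>k. central ((poly.coeff (Xn n) [^]\<^bsub>R\<^esub> i) k) \<and>
      lev (max 0 (int i - int k)) ((poly.coeff (Xn n) [^]\<^bsub>R\<^esub> i) k))"
proof (induction i)
  case 0
  have "poly.coeff (Xn n) [^]\<^bsub>R\<^esub> (0::nat) = (\<lambda>k. if k = 0 then 1 else 0)"
    by (simp add: R_def nat_pow_def skew_series_ring_def)
  then show ?case
    using central_one central_zero Q.one_bounded_series by simp
next
  case (Suc i)
  let ?g = "poly.coeff (Xn n)"
  have step: "?g [^]\<^bsub>R\<^esub> Suc i = Q.smult (?g [^]\<^bsub>R\<^esub> i) ?g"
    using Suc by (simp add: R_def nat_pow_def skew_series_ring_def Q.skew_series_mult_eq)
  also have "\<dots> = (\<lambda>k. \<Sum>j\<le>k. (?g [^]\<^bsub>R\<^esub> i) j * ?g (k - j))"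
    using central_Xn central_delta by (intro ext Q.smult_central) (simp_all add: central_def)
  finally have eq: "?g [^]\<^bsub>R\<^esub> Suc i = (\<lambda>k. \<Sum>j\<le>k. (?g [^]\<^bsub>R\<^esub> i) j * ?g (k - j))" .
  have "central ((?g [^]\<^bsub>R\<^esub> Suc i) k)" for k
    unfolding eq using Suc by (intro central_sum central_mult central_Xn) blast
  moreover have "lev (max 0 (int (Suc i) - int k)) ((?g [^]\<^bsub>R\<^esub> Suc i) k)" for k
    unfolding eq
  proof (rule w_sum)
    fix j
    assume j: "j \<in> {..k}"
    have "lev (max 0 (int i - int j)) ((?g [^]\<^bsub>R\<^esub> i) j)"
      using Suc by blast
    \<comment> \<open>The two levels suffice since
      \<open>(i - j) + (1 - (k - j)) = i + 1 - k\<close> and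
      \<open>max 0 a + max 0 b \<ge> max 0 (a + b)\<close>.\<close>
    from lev_mono[OF lev_mult[OF this lev_Xn[of "k - j"]], of "max 0 (int (Suc i) - int k)"] j
    show "lev (max 0 (int (Suc i) - int k)) ((?g [^]\<^bsub>R\<^esub> i) j * ?g (k - j))"
      by (simp add: of_nat_diff)
  qed
  moreover have "?g [^]\<^bsub>R\<^esub> Suc i \<in> bounded_series w"
    unfolding step using Suc by (intro Q.smult_bounded poly_bounded_series) blast
  ultimately show ?case by blast
qed

text \<open>Termwise: the coefficient of index \<open>i\<close> has value at least
  \<open>r - \<epsilon> * i\<close>, and entry \<open>k\<close> of the power \<open>i\<close> makes
  up for the difference \<open>\<epsilon> * (i - k)\<close>.\<close>

lemma filtered_theta:
  assumes \<epsilon>: "0 < \<epsilon>" "\<epsilon> < 1" and f: "ereal r \<le> poly_filtration w \<epsilon> f"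
    and \<theta>: "\<And>k. \<theta> k = (\<Sum>i\<le>Polynomial.degree f. poly.coeff f i *
      (poly.coeff (Xn n) [^]\<^bsub>skew_series_ring w \<sigma> \<delta>\<^esub> i) k)"
  shows "ereal r \<le> series_filtration w \<epsilon> \<theta>"
proof -
  have shift_iff: "ereal r \<le> w s + ereal y \<longleftrightarrow> ereal (r - y) \<le> w s" for s y
    by (cases "w s") auto
  have f': "ereal (r - \<epsilon> * real i) \<le> w (poly.coeff f i)" for i
    using f unfolding poly_filtration_def series_filtration_def le_INF_iff shift_iff by blast
  have "ereal (r - \<epsilon> * real k) \<le> w (\<theta> k)" for k
    unfolding \<theta>
  proof (rule w_sum)
    fix i
    let ?m = "max 0 (int i - int k)"
    \<comment> \<open>The bound \<epsilon> < 1 serves for \<open>k \<le> i\<close>, and \<epsilon> >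
      0 for \<open>k > i\<close>, where the left side is negative.\<close>
    have "\<epsilon> * (real i - real k) \<le> real_of_int ?m"
    proof (cases "k \<le> i")
      case True
      then have "\<epsilon> * (real i - real k) \<le> 1 * (real i - real k)"
        using \<epsilon> by (intro mult_right_mono) auto
      then show ?thesis
        using True by simp
    next
      case False
      then have "\<epsilon> * (real i - real k) \<le> 0"
        using \<epsilon> by (intro mult_nonneg_nonpos) auto
      then show ?thesis
        using False by simp
    qed
    then have "ereal (r - \<epsilon> * real k) \<le> ereal (r - \<epsilon> * real i) + ereal (of_int ?m)"
      by (simp add: algebra_simps)
    also have "\<dots> \<le> w (poly.coeff f i * (poly.coeff (Xn n) [^]\<^bsub>skew_series_ring w \<sigma> \<delta>\<^esub> i) k)"
      using Xn_power by (intro w_mult f') blast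
    finally show "ereal (r - \<epsilon> * real k) \<le>
        w (poly.coeff f i * (poly.coeff (Xn n) [^]\<^bsub>skew_series_ring w \<sigma> \<delta>\<^esub> i) k)" .
  qed
  then show ?thesis
    unfolding series_filtration_def le_INF_iff shift_iff by blast
qed

section \<open>Substitution of \<open>Xn n\<close> as a filtered ring homomorphism\<close>

context
  fixes n :: nat
begin

definition G :: "nat \<Rightarrow> nat \<Rightarrow> 'a" where
  "G i = poly.coeff (Xn n) [^]\<^bsub>skew_series_ring w \<sigma> \<delta>\<^esub> i"

text \<open>The natural map with its ring sum written coefficientwise, so that ordinary finite sums
  apply.\<close>

definition theta :: "'a poly \<Rightarrow> nat \<Rightarrow> 'a" where
  "theta f = (\<lambda>k. \<Sum>i\<le>Polynomial.degree f. poly.coeff f i * G i k)"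

lemma G_bounded: "G i \<in> bounded_series w"
  unfolding G_def using Xn_power by blast

lemma G_0: "G 0 = (\<lambda>k. if k = 0 then 1 else 0)"
  by (simp add: G_def nat_pow_def skew_series_ring_def)

text \<open>Powers are defined by multiplying on the right; the comparison with left multiplication
  by \<open>Y\<close> needs the new factor on the left.\<close>

lemma G_Suc: "G (Suc i) = Q.smult (poly.coeff (Xn n)) (G i)"
proof -
  interpret R: ring "skew_series_ring w \<sigma> \<delta>"
    by (rule Q.ring_skew_series_ring)
  have "poly.coeff (Xn n) \<in> carrier (skew_series_ring w \<sigma> \<delta>)"
    by (simp add: skew_series_ring_def poly_bounded_series)
  from R.nat_pow_Suc2[OF this, of i] show ?thesis
    by (simp add: G_def skew_series_ring_def Q.skew_series_mult_eq poly_bounded_series)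
qed

lemma theta_eq:
  assumes "Polynomial.degree f \<le> m"
  shows "theta f = (\<lambda>k. \<Sum>i\<le>m. poly.coeff f i * G i k)"
  unfolding theta_def
  by (rule ext, rule sum.mono_neutral_left) (use assms in \<open>auto simp: coeff_eq_0\<close>)

lemma theta_bounded: "theta f \<in> bounded_series w"
  unfolding theta_def by (intro Q.bounded_series_sum Q.bounded_series_scale G_bounded)

lemma theta_add: "theta (f + g) = (\<lambda>k. theta f k + theta g k)"
proof -
  define m where "m = max (Polynomial.degree f) (Polynomial.degree g)"
  have "Polynomial.degree (f + g) \<le> m" "Polynomial.degree f \<le> m" "Polynomial.degree g \<le> m"
    using degree_add_le_max[of f g] by (auto simp: m_def)
  from this[THEN theta_eq] show ?thesis
    by (simp add: distrib_right sum.distrib)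
qed

lemma theta_zero: "theta 0 = (\<lambda>k. 0)"
  by (simp add: theta_def)

lemma theta_sum: "theta (sum f I) = (\<lambda>k. \<Sum>i\<in>I. theta (f i) k)"
  by (induction I rule: infinite_finite_induct) (simp_all add: theta_zero theta_add)

lemma theta_scale: "theta (map_poly ((*) s) f) = (\<lambda>k. s * theta f k)"
proof -
  have "Polynomial.degree (map_poly ((*) s) f) \<le> Polynomial.degree f"
    by (rule degree_le) (simp add: coeff_map_poly coeff_eq_0)
  from theta_eq[OF this] show ?thesis
    by (simp add: theta_def coeff_map_poly sum_distrib_left mult.assoc)
qed

lemma Xn_scale:
  assumes "b \<in> bounded_series w"
  shows "Q.smult (poly.coeff (Xn n)) (\<lambda>k. s * b k) =
    (\<lambda>k. Sign n s * Q.smult (poly.coeff (Xn n)) b k + Deln n s * b k)"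
proof -
  have "Q.smult (poly.coeff (Xn n)) (\<lambda>k. s * b k) =
      Q.smult (Q.smult (poly.coeff (Xn n)) (\<lambda>k. if k = 0 then s else 0)) b"
    by (simp add: Q.smult_assoc[OF poly_bounded_series Q.const_bounded_series, symmetric] Q.smult_const_left)
  then show ?thesis
    unfolding smult_Xn_const
    by (simp add: Q.smult_add_left Q.bounded_series_scale poly_bounded_series Q.const_bounded_series
        Q.smult_scale_left Q.smult_const_left)
qed

text \<open>Moving \<open>Xn n\<close> past each coefficient obeys the same rule as moving
  \<open>Y\<close>, so left multiplication by \<open>Y\<close> becomes left multiplication by
  \<open>Xn n\<close>.\<close>

lemma theta_var_mult:
  "theta (skew_var_mult (Sign n) (Deln n) f) = Q.smult (poly.coeff (Xn n)) (theta f)"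
proof -
  let ?m = "Polynomial.degree f"
  have Sign0: "Sign n 0 = 0" and Deln0: "Deln n 0 = 0"
    by (simp_all add: Sign_def additive.zero[OF sigma_pow_additive] additive.zero[OF Deln_additive])
  have c: "poly.coeff (skew_var_mult (Sign n) (Deln n) f) i =
      (case i of 0 \<Rightarrow> 0 | Suc j \<Rightarrow> Sign n (poly.coeff f j)) + Deln n (poly.coeff f i)" for i
    by (simp add: skew_var_mult_def coeff_map_poly Sign0 Deln0 coeff_pCons split: nat.split)
  have "Polynomial.degree (skew_var_mult (Sign n) (Deln n) f) \<le> Suc ?m"
    by (rule degree_le) (auto simp: c coeff_eq_0 Sign0 Deln0 split: nat.split)
  from theta_eq[OF this]
  have "theta (skew_var_mult (Sign n) (Deln n) f) =
      (\<lambda>k. (\<Sum>i\<le>Suc ?m. (case i of 0 \<Rightarrow> 0 | Suc j \<Rightarrow> Sign n (poly.coeff f j)) * G i k) +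
        (\<Sum>i\<le>Suc ?m. Deln n (poly.coeff f i) * G i k))"
    by (simp only: c distrib_right sum.distrib)
  \<comment> \<open>The \<open>Sign n\<close> part is reindexed by one; the top term of the
    \<open>Deln n\<close> part vanishes, as its coefficient lies beyond the degree.\<close>
  also have "\<dots> = (\<lambda>k. (\<Sum>i\<le>?m. Sign n (poly.coeff f i) * G (Suc i) k + Deln n (poly.coeff f i) * G i k))"
    by (subst sum.atMost_Suc_shift) (simp add: sum.distrib coeff_eq_0 Deln0)
  also have "\<dots> = (\<lambda>k. \<Sum>i\<le>?m. Q.smult (poly.coeff (Xn n)) (\<lambda>k. poly.coeff f i * G i k) k)"
    by (simp add: Xn_scale[OF G_bounded] G_Suc)
  also have "\<dots> = Q.smult (poly.coeff (Xn n)) (theta f)"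
    unfolding theta_def by (simp add: Q.smult_sum_right[OF poly_bounded_series])
  finally show ?thesis .
qed

lemma theta_var_mult_pow:
  "theta ((skew_var_mult (Sign n) (Deln n) ^^ i) f) = Q.smult (G i) (theta f)"
proof (induction i)
  case 0
  then show ?case
    by (simp only: G_0 Q.smult_const_left) simp
next
  case (Suc i)
  then show ?case
    by (simp add: theta_var_mult G_Suc Q.smult_assoc poly_bounded_series G_bounded)
qed

text \<open>By left linearity it is enough to multiply \<open>g\<close> by powers of
  \<open>Y\<close>, which \<open>theta\<close> turns into powers of \<open>Xn n\<close>.\<close>

lemma theta_mult: "theta (skew_poly_mult (Sign n) (Deln n) f g) = Q.smult (theta f) (theta g)"
proof -
  have "theta (skew_poly_mult (Sign n) (Deln n) f g) =
      (\<lambda>k. \<Sum>i\<le>Polynomial.degree f. poly.coeff f i * Q.smult (G i) (theta g) k)"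
    unfolding skew_poly_mult_def theta_sum theta_scale theta_var_mult_pow ..
  also have "\<dots> = Q.smult (theta f) (theta g)"
    unfolding theta_def[of f]
    by (simp add: Q.smult_sum_left Q.bounded_series_scale G_bounded Q.smult_scale_left)
  finally show ?thesis .
qed

lemma theta_const: "theta [:s:] = poly.coeff [:s:]"
  by (auto simp: theta_def G_0 Q.coeff_const)

lemma theta_var: "theta [:0, 1:] = poly.coeff (Xn n)"
  by (simp add: theta_def G_Suc G_0 Q.smult_one_right)

lemma skew_subst_eq: "skew_subst w \<sigma> \<delta> (Xn n) = theta"
proof
  fix f
  let ?R = "skew_series_ring w \<sigma> \<delta>"
  interpret R: ring ?R
    by (rule Q.ring_skew_series_ring)
  have carrier: "carrier ?R = bounded_series w"
    by (simp add: skew_series_ring_def)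
  have "finsum ?R h I = (\<lambda>k. \<Sum>i\<in>I. h i k)" if "finite I" "h \<in> I \<rightarrow> carrier ?R" for h and I :: "nat set"
    using that
  proof (induction I)
    case empty
    then show ?case
      by (simp only: R.finsum_empty) (simp add: skew_series_ring_def)
  next
    case (insert i I)
    then have "finsum ?R h (insert i I) = h i \<oplus>\<^bsub>?R\<^esub> finsum ?R h I"
      by (intro R.finsum_insert) auto
    also have "\<dots> = (\<lambda>k. \<Sum>j\<in>insert i I. h j k)"
      using insert by (simp add: skew_series_ring_def)
    finally show ?case .
  qed
  note finsum = this
  have mult: "poly.coeff [:s:] \<otimes>\<^bsub>?R\<^esub> G i = (\<lambda>k. s * G i k)" for s i
    using Q.skew_series_mult_eq[OF poly_bounded_series[of "[:s:]"]]
    by (simp add: skew_series_ring_def Q.coeff_const Q.smult_const_left)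
  show "skew_subst w \<sigma> \<delta> (Xn n) f = theta f"
    unfolding skew_subst_def Let_def theta_def G_def[symmetric] mult
    by (rule finsum) (auto simp: carrier intro: Q.bounded_series_scale G_bounded)
qed

theorem natural_map:
  assumes \<epsilon>: "0 < \<epsilon>" "\<epsilon> < 1"
  defines "A \<equiv> skew_poly_ring (Sign n) (Deln n)" and "B \<equiv> skew_series_ring w \<sigma> \<delta>"
  shows "ring_hom_ring A B theta"
    and "filtered_map (value_group \<epsilon>) (carrier A) (poly_filtration w \<epsilon>) (carrier B) (series_filtration w \<epsilon>) theta"
    and "0 \<le> filt_degree (value_group \<epsilon>) (carrier A) (poly_filtration w \<epsilon>) (carrier B) (series_filtration w \<epsilon>) theta"
proof -
  interpret P: quasi_compatible_ring w "Sign n" "Deln n"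
    by unfold_locales (simp add: quasi_compatible_Deln_iff Q.qc)
  show "ring_hom_ring A B theta"
    unfolding A_def B_def
  proof (rule ring_hom_ringI[OF P.ring_skew_poly_ring Q.ring_skew_series_ring])
    show "theta \<one>\<^bsub>skew_poly_ring (Sign n) (Deln n)\<^esub> = \<one>\<^bsub>skew_series_ring w \<sigma> \<delta>\<^esub>"
      using theta_const[of 1] by (simp add: skew_poly_ring_def skew_series_ring_def Q.coeff_const)
  qed (simp_all add: skew_poly_ring_def skew_series_ring_def theta_bounded theta_mult theta_add
      Q.skew_series_mult_eq)
  have shifts: "shifts_by (value_group \<epsilon>) (carrier A) (poly_filtration w \<epsilon>) (carrier B) (series_filtration w \<epsilon>) theta 0"
  proof -
    have "ereal r \<le> series_filtration w \<epsilon> (theta f)" if "ereal r \<le> poly_filtration w \<epsilon> f" for r f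
      by (rule filtered_theta[OF \<epsilon> that]) (simp add: theta_def G_def)
    then show ?thesis
      by (auto simp: shifts_by_def filt_level_def B_def skew_series_ring_def theta_bounded)
  qed
  have zero: "0 \<in> value_group \<epsilon>"
    unfolding value_group_def by (auto intro!: exI[of _ 0])
  show "filtered_map (value_group \<epsilon>) (carrier A) (poly_filtration w \<epsilon>) (carrier B) (series_filtration w \<epsilon>) theta"
    unfolding filtered_map_def using shifts zero by blast
  show "0 \<le> filt_degree (value_group \<epsilon>) (carrier A) (poly_filtration w \<epsilon>) (carrier B) (series_filtration w \<epsilon>) theta"
    unfolding filt_degree_def using shifts zero by (intro Sup_upper) (auto simp: zero_ereal_def)
qed

end

end

text \<open>The integers map to the \<open>p\<close>-adic integers, where -1 has valuation at least
  0 and \<open>p\<close> at least 1; the structure map carries these bounds over.\<close>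

lemma filtered_padic_algebra_consts:
  assumes "prime p" and alg: "filtered_padic_algebra p \<iota> w"
  shows "0 \<le> w (- 1)" "1 \<le> w (of_nat p)"
proof -
  let ?Z = "padic_int p"
  \<comment> \<open>The integer \<open>m\<close> as a \<open>p\<close>-adic integer, given by its
    residues modulo all powers of \<open>p\<close>.\<close>
  define c :: "int \<Rightarrow> nat \<Rightarrow> int" where "c m = (\<lambda>n. m mod int p ^ n)" for m
  have hom: "\<iota> \<in> ring_hom ?Z ring_of_type_algebra"
    and val: "\<And>a. a \<in> carrier ?Z \<Longrightarrow> padic_val a \<le> w (\<iota> a)"
    using alg unfolding filtered_padic_algebra_def by auto
  have carrier: "c m \<in> carrier ?Z" for m
    using prime_gt_0_nat[OF \<open>prime p\<close>] by (simp add: c_def padic_int_def mod_mod_cancel)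
  have add: "\<iota> (c (m + k)) = \<iota> (c m) + \<iota> (c k)" for m k
    using ring_hom_add[OF hom carrier carrier, of m k]
    by (simp add: padic_int_def ring_of_type_algebra_def c_def mod_add_eq)
  have one: "\<iota> (c 1) = 1"
    using ring_hom_one[OF hom] by (simp add: padic_int_def ring_of_type_algebra_def c_def)
  have zero: "\<iota> (c 0) = 0"
    using add[of 0 0] by simp
  have nat: "\<iota> (c (int k)) = of_nat k" for k
    by (induction k) (simp_all add: zero one add add.commute[of 1 "int _"])
  have le: "ereal (real k) \<le> w (\<iota> (c m))" if "c m k = 0" for m k
  proof -
    have "ereal (real k) \<le> padic_val (c m)"
      unfolding padic_val_def using that by (intro Sup_upper) auto
    then show ?thesis
      using val[OF carrier] by (rule order_trans)
  qed
  have "\<iota> (c (- 1)) = - 1"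
    using add[of "- 1" 1] zero one by (simp add: eq_neg_iff_add_eq_0)
  \<comment> \<open>Residues modulo \<open>p ^ 0\<close> are all 0, so every valuation is at least
    0.\<close>
  with le[of "- 1" 0] show "0 \<le> w (- 1)"
    by (simp add: c_def zero_ereal_def)
  show "1 \<le> w (of_nat p)"
    using le[of "int p" 1] nat[of p] by (simp add: c_def one_ereal_def)
qed

theorem theorem3p4p7:
  fixes p :: nat
    and w :: "'a::ring_1 \<Rightarrow> ereal"
    and \<iota> :: "(nat \<Rightarrow> int) \<Rightarrow> 'a"
    and \<sigma> \<delta> :: "'a \<Rightarrow> 'a"
    and t :: 'a
    and T :: "nat \<Rightarrow> 'a"
    and Xn :: "nat \<Rightarrow> 'a poly"
    and Sig Del :: "nat \<Rightarrow> 'a \<Rightarrow> 'a"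
  assumes "prime p"
    and "filtered_padic_algebra p \<iota> w" and "filt_complete w"
    and "commuting_skew_derivation \<sigma> \<delta>"
    and "filtered_endo w \<sigma>"
    and "\<exists>r. strictly_filtered_endo w (\<sigma> ^^ (p ^ r))"
    and "\<And>s. \<delta> s = t * s - \<sigma> s * t"
    and "\<sigma> t = t"
    and "of_nat p \<noteq> (0::'a) \<Longrightarrow> 0 \<le> w t"
    and "\<And>n. T n = (- 1) ^ (p + 1) * t ^ (p ^ n)"
    and "\<And>n. Xn n = ([:0, 1:] - [:t:]) [^]\<^bsub>skew_poly_ring \<sigma> \<delta>\<^esub> (p ^ n) + [:T n:]"
    and "\<And>n. Sig n = \<sigma> ^^ (p ^ n)"
    and "\<And>n s. Del n s = T n * s - Sig n s * T n"
  shows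
    "(quasi_compatible w \<sigma> \<delta> \<longleftrightarrow> (\<forall>n. quasi_compatible w (Sig n) (Del n))) \<and>
     (quasi_compatible w \<sigma> \<delta> \<longleftrightarrow> (\<exists>n. quasi_compatible w (Sig n) (Del n))) \<and>
     (skew_series_ring_exists w \<sigma> \<delta> \<longleftrightarrow> (\<forall>n. skew_series_ring_exists w (Sig n) (Del n))) \<and>
     (skew_series_ring_exists w \<sigma> \<delta> \<longleftrightarrow> (\<exists>n. skew_series_ring_exists w (Sig n) (Del n))) \<and>
     (quasi_compatible w \<sigma> \<delta> \<longrightarrow>
       (\<forall>n. \<exists>\<epsilon>\<^sub>0>0. \<forall>\<epsilon>\<in>\<rat>. 0 < \<epsilon> \<and> \<epsilon> < \<epsilon>\<^sub>0 \<longrightarrow>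
         (let A = skew_poly_ring (Sig n) (Del n);
              B = skew_series_ring w \<sigma> \<delta>;
              \<theta> = skew_subst w \<sigma> \<delta> (Xn n);
              v\<^sub>Y = poly_filtration w \<epsilon>;
              v\<^sub>x = series_filtration w \<epsilon>
          in ring_hom_ring A B \<theta> \<and>
             (\<forall>s. \<theta> [:s:] = poly.coeff [:s:]) \<and>
             \<theta> [:0, 1:] = poly.coeff (Xn n) \<and>
             filtered_map (value_group \<epsilon>) (carrier A) v\<^sub>Y (carrier B) v\<^sub>x \<theta> \<and>
             0 \<le> filt_degree (value_group \<epsilon>) (carrier A) v\<^sub>Y (carrier B) v\<^sub>x \<theta>)))"
proof -
  interpret complete_filtered_ring w
    using assms(2,3) filtered_padic_algebra_consts(1)[OF assms(1,2)]
    by unfold_locales (simp_all add: filtered_padic_algebra_def)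
  have bij: "bij \<sigma>"
    using assms(4) unfolding commuting_skew_derivation_def skew_derivation_iff by blast
  obtain d where d: "shift \<sigma> d"
    using assms(5) unfolding filtered_endo_iff by blast
  obtain r where r: "strictly_filtered_endo w (\<sigma> ^^ (p ^ r))"
    using assms(6) by blast
  obtain D where D: "\<And>i. shift (int_funpow \<sigma> i) D"
    using int_funpow_shift_bounded[OF bij d _ r] prime_gt_0_nat[OF assms(1)] by auto
  interpret inner_skew_derivation w \<sigma> \<delta> t p D
    using assms(1,4,7,8,9) D filtered_padic_algebra_consts(2)[OF assms(1,2)]
    unfolding commuting_skew_derivation_def skew_derivation_iff
    by unfold_locales (simp_all add: zero_ereal_def one_ereal_def)
  have T: "T = Tn" and Sig: "Sig = Sign" and Del: "Del = Deln"
    using assms(10,12,13) by (auto simp: fun_eq_iff Tn_def Sign_def Deln_def)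
  have qc: "quasi_compatible w (Sig n) (Del n) \<longleftrightarrow> quasi_compatible w \<sigma> \<delta>" for n
    unfolding Sig Del by (rule quasi_compatible_Deln_iff)
  \<comment> \<open>The filtration is complete, so quasi-compatibility already yields the ring; the
    converse is part of the definition of existence.\<close>
  have exists_iff: "skew_series_ring_exists w \<tau> e \<longleftrightarrow> quasi_compatible w \<tau> e" for \<tau> e
  proof
    assume "quasi_compatible w \<tau> e"
    then interpret quasi_compatible_ring w \<tau> e
      by unfold_locales
    show "skew_series_ring_exists w \<tau> e"
      by (rule skew_series_ring_exists)
  qed (simp add: skew_series_ring_exists_def)
  show ?thesis
    unfolding exists_iff qc
  proof (intro conjI impI allI)
    fix n
    assume "quasi_compatible w \<sigma> \<delta>"
    then interpret I: inner_quasi_compatible w \<sigma> \<delta> t p D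
      by unfold_locales
    have X: "Xn n = I.Xn n"
      using assms(11) by (simp add: I.Xn_def T)
    show "\<exists>\<epsilon>\<^sub>0>0. \<forall>\<epsilon>\<in>\<rat>. 0 < \<epsilon> \<and> \<epsilon> < \<epsilon>\<^sub>0 \<longrightarrow>
         (let A = skew_poly_ring (Sig n) (Del n);
              B = skew_series_ring w \<sigma> \<delta>;
              \<theta> = skew_subst w \<sigma> \<delta> (Xn n);
              v\<^sub>Y = poly_filtration w \<epsilon>;
              v\<^sub>x = series_filtration w \<epsilon>
          in ring_hom_ring A B \<theta> \<and>
             (\<forall>s. \<theta> [:s:] = poly.coeff [:s:]) \<and>
             \<theta> [:0, 1:] = poly.coeff (Xn n) \<and>
             filtered_map (value_group \<epsilon>) (carrier A) v\<^sub>Y (carrier B) v\<^sub>x \<theta> \<and>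
             0 \<le> filt_degree (value_group \<epsilon>) (carrier A) v\<^sub>Y (carrier B) v\<^sub>x \<theta>)"
      \<comment> \<open>The threshold 1 for \<epsilon> works for every \<open>n\<close>.\<close>
      unfolding Let_def X I.skew_subst_eq Sig Del
      using I.natural_map I.theta_const I.theta_var by (intro exI[of _ 1]) auto
  qed auto
qed

end
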